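(* Let $M\subset\mathbb{R}^2$ be the closed unit disk and let $g_1,g_2$ be $C^{1,1}$ Riemannian metrics on $M$ such that $d_{g_1}|_{\partial M\times\partial M}=d_{g_2}|_{\partial M\times\partial M}$. Then there exists a $C^{2,1}$ diffeomorphism $\psi:M\to M$ with $\psi|_{\partial M}=\mathrm{id}$ such that $\psi^*g_1|_{\partial M}=g_2|_{\partial M}$.
   Context: A $C^{1,1}$ metric is one whose components in the standard coordinates are $C^1$ with Lipschitz first derivatives, up to the boundary. For a metric $g$ on $M$, $d_g(x,y)$ is the Riemannian distance in $(M,g)$, i.e. the infimum of $g$-lengths of curves in $M$ joining $x$ to $y$; its restriction to $\partial M\times\partial M$ is the boundary distance function. The equality $\psi^*g_1|_{\partial M}=g_2|_{\partial M}$ means that for every $p\in\partial M$ the bilinear forms $(\psi^*g_1)_p$ and $(g_2)_p$ agree on the whole tangent space $T_pM$ (not only on $T_p\partial M$). *)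

theory Defs
  imports "HOL-Analysis.Analysis"
begin

text \<open>
  Regularity classes up to the boundary are expressed by one-sided derivatives (at x within S).
  These determine the derivative only if the tangent directions of S span the space at
  each point, as is the case for a convex set with nonempty interior, such as a closed ball.
\<close>

definition C11_on :: "'a::real_normed_vector set \<Rightarrow> ('a \<Rightarrow> 'b::real_normed_vector) \<Rightarrow> bool"
  where "C11_on S f \<longleftrightarrow>
    (\<exists>f' :: 'a \<Rightarrow> 'a \<Rightarrow>\<^sub>L 'b.
      (\<forall>x\<in>S. (f has_derivative blinfun_apply (f' x)) (at x within S)) \<and>
      (\<exists>L. L-lipschitz_on S f'))"

definition C21_on :: "'a::real_normed_vector set \<Rightarrow> ('a \<Rightarrow> 'b::real_normed_vector) \<Rightarrow> bool"
  where "C21_on S f \<longleftrightarrow>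
    (\<exists>f' :: 'a \<Rightarrow> 'a \<Rightarrow>\<^sub>L 'b.
      (\<forall>x\<in>S. (f has_derivative blinfun_apply (f' x)) (at x within S)) \<and>
      C11_on S f')"

definition C21_diffeomorphism ::
    "'a::real_normed_vector set \<Rightarrow> 'b::real_normed_vector set \<Rightarrow> ('a \<Rightarrow> 'b) \<Rightarrow> bool"
  where "C21_diffeomorphism S T f \<longleftrightarrow>
    bij_betw f S T \<and> C21_on S f \<and> C21_on T (inv_into S f)"

text \<open>
  A metric assigns to each point a bilinear form on the tangent space, which is identified
  with the ambient vector space; only its values at points of S matter.
\<close>

definition C11_riemannian_metric ::
    "'a::euclidean_space set \<Rightarrow> ('a \<Rightarrow> 'a \<Rightarrow> 'a \<Rightarrow> real) \<Rightarrow> bool"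
  where "C11_riemannian_metric S g \<longleftrightarrow>
    (\<forall>p\<in>S. bilinear (g p) \<and> (\<forall>v w. g p v w = g p w v) \<and> (\<forall>v. v \<noteq> 0 \<longrightarrow> 0 < g p v v)) \<and>
    (\<forall>i\<in>Basis. \<forall>j\<in>Basis. C11_on S (\<lambda>p. g p i j))"

definition riem_speed ::
    "('a::real_normed_vector \<Rightarrow> 'a \<Rightarrow> 'a \<Rightarrow> real) \<Rightarrow> (real \<Rightarrow> 'a) \<Rightarrow> real \<Rightarrow> real"
  where "riem_speed g \<gamma> t =
    (let v = vector_derivative \<gamma> (at t within {0..1}) in sqrt (g (\<gamma> t) v v))"

definition riem_length ::
    "('a::real_normed_vector \<Rightarrow> 'a \<Rightarrow> 'a \<Rightarrow> real) \<Rightarrow> (real \<Rightarrow> 'a) \<Rightarrow> real"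
  where "riem_length g \<gamma> = integral {0..1} (riem_speed g \<gamma>)"

text \<open>
  Library valid paths are continuous and $C^1$ off a finite set of parameters, where the
  derivative may be unbounded.  A curve of infinite length has a non-integrable speed, whose
  integral is 0 by convention; such curves are therefore excluded from the infimum.
\<close>

definition riem_curves ::
    "'a::real_normed_vector set \<Rightarrow> ('a \<Rightarrow> 'a \<Rightarrow> 'a \<Rightarrow> real) \<Rightarrow> 'a \<Rightarrow> 'a \<Rightarrow> (real \<Rightarrow> 'a) set"
  where "riem_curves S g x y =
    {\<gamma>. valid_path \<gamma> \<and> path_image \<gamma> \<subseteq> S \<and> pathstart \<gamma> = x \<and> pathfinish \<gamma> = y \<and>
         riem_speed g \<gamma> integrable_on {0..1}}"

definition riem_dist ::
    "'a::real_normed_vector set \<Rightarrow> ('a \<Rightarrow> 'a \<Rightarrow> 'a \<Rightarrow> real) \<Rightarrow> 'a \<Rightarrow> 'a \<Rightarrow> real"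
  where "riem_dist S g x y = (INF \<gamma>\<in>riem_curves S g x y. riem_length g \<gamma>)"

definition pullback_metric ::
    "'a::real_normed_vector set \<Rightarrow> ('a \<Rightarrow> 'b::real_normed_vector) \<Rightarrow>
     ('b \<Rightarrow> 'b \<Rightarrow> 'b \<Rightarrow> real) \<Rightarrow> 'a \<Rightarrow> 'a \<Rightarrow> 'a \<Rightarrow> real"
  where "pullback_metric S \<psi> g p v w =
    (let D = frechet_derivative \<psi> (at p within S) in g (\<psi> p) (D v) (D w))"

abbreviation unit_disk :: "(real^2) set"
  where "unit_disk \<equiv> cball 0 1"

abbreviation unit_circle :: "(real^2) set"
  where "unit_circle \<equiv> sphere 0 1"

end

theory Submission
  imports Defs
begin

text \<open>
  A curve in the disk of small length stays close to its starting point, where the metric is nearly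
  constant; comparing with chords shows that the boundary distance determines the metric on vectors
  tangent to the circle. It remains to find a diffeomorphism fixing the circle whose normal
  derivative \<open>\<alpha> p + \<beta> Jp\<close> (\<open>J\<close> the quarter turn) at boundary points \<open>p\<close> is prescribed, where \<open>\<alpha> > 0\<close> and \<open>\<beta>\<close> are
  only \<open>C\<^sup>1\<^sup>,\<^sup>1\<close> functions of the angle. d'Alembert's formula extends such data to the disk without
  losing a derivative. Small data give a perturbation of the identity that is inverted by Banach's
  fixed point theorem; general data are reached by composing many diffeomorphisms of this kind,
  since \<open>\<alpha>\<close> is a power of a function close to 1 and \<open>\<beta>\<close> a multiple of a small one.
\<close>

subsection \<open>Maps with Lipschitz derivatives\<close>

text \<open>In the frame (p, Jp) a metric has three coefficients at p, and the differential of a map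
  fixing the circle is the matrix with columns (\<alpha>, \<beta>) and (0, 1). The distance settles
  the coefficient on Jp. Comparing Gram determinants then forces \<alpha> to be the square root of
  their quotient, and the mixed coefficient forces \<beta>; with these two choices the third
  coefficient matches as well. The obstacle is regularity: \<alpha> and \<beta> are only as smooth
  as the metrics, while the diffeomorphism must have one derivative more. Multiplying data
  a(\<theta>) by a function of the radius vanishing on the circle would only be C^{1,1}. In
  h(\<theta> + t) - h(\<theta> - t), with h an antiderivative of a, the integration along the circle
  regains the missing derivative, while the derivative in t at t = 0 is still 2 a(\<theta>). Neither
  h nor the angle is single valued on the disk, but this difference does not depend on the branch of
  the angle; its singularity at the centre is cut off.\<close>

lemma lipschitz_on_bounded_norm:
  fixes f :: "'a::real_normed_vector \<Rightarrow> 'b::real_normed_vector"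
  assumes "bounded S" "L-lipschitz_on S f"
  obtains B where "B > 0" "\<And>x. x \<in> S \<Longrightarrow> norm (f x) \<le> B"
proof (cases "S = {}")
  case True
  then show ?thesis using that[of 1] by simp
next
  case False
  then obtain a where a: "a \<in> S" by blast
  have L: "L \<ge> 0" using assms(2) lipschitz_on_nonneg by blast
  obtain e where e: "\<And>x. x \<in> S \<Longrightarrow> dist a x \<le> e" "e \<ge> 0"
    by (metis assms(1) bounded_any_center zero_le_dist a order_trans)
  show ?thesis
  proof (rule that[of "norm (f a) + L * e + 1"])
    show "norm (f a) + L * e + 1 > 0" using L e by (simp add: add_nonneg_pos)
    fix x assume x: "x \<in> S"
    have "norm (f x - f a) \<le> L * dist x a"
      using lipschitz_onD[OF assms(2) x a] by (simp add: dist_norm)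
    also have "\<dots> \<le> L * e" using e(1)[OF x] L by (simp add: dist_commute mult_left_mono)
    finally show "norm (f x) \<le> norm (f a) + L * e + 1"
      using norm_triangle_sub[of "f x" "f a"] by linarith
  qed
qed

lemma lipschitz_on_bilinear:
  fixes f :: "'a::real_normed_vector \<Rightarrow> 'b::real_normed_vector"
    and g :: "'a \<Rightarrow> 'c::real_normed_vector"
    and prod :: "'b \<Rightarrow> 'c \<Rightarrow> 'd::real_normed_vector"
  assumes "bounded_bilinear prod" "bounded S" "L-lipschitz_on S f" "M-lipschitz_on S g"
  shows "\<exists>K. K-lipschitz_on S (\<lambda>x. prod (f x) (g x))"
proof -
  interpret bounded_bilinear prod by fact
  obtain K where K: "K > 0" "\<And>a b. norm (prod a b) \<le> norm a * norm b * K"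
    using pos_bounded by blast
  obtain A where A: "A > 0" "\<And>x. x \<in> S \<Longrightarrow> norm (f x) \<le> A"
    using lipschitz_on_bounded_norm assms by metis
  obtain B where B: "B > 0" "\<And>x. x \<in> S \<Longrightarrow> norm (g x) \<le> B"
    using lipschitz_on_bounded_norm assms by metis
  have L: "L \<ge> 0" and M: "M \<ge> 0" using assms lipschitz_on_nonneg by blast+
  have "(A * M * K + L * B * K)-lipschitz_on S (\<lambda>x. prod (f x) (g x))"
  proof (rule lipschitz_onI)
    fix x y assume x: "x \<in> S" and y: "y \<in> S"
    have "prod (f x) (g x) - prod (f y) (g y) = prod (f x) (g x - g y) + prod (f x - f y) (g y)"
      by (simp add: diff_left diff_right)
    then have "norm (prod (f x) (g x) - prod (f y) (g y))
        \<le> norm (f x) * norm (g x - g y) * K + norm (f x - f y) * norm (g y) * K"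
      by (simp only:) (intro norm_triangle_mono K(2))
    also have "\<dots> \<le> A * (M * dist x y) * K + (L * dist x y) * B * K"
      using A B K L M x y lipschitz_onD[OF assms(3) x y] lipschitz_onD[OF assms(4) x y]
      by (intro add_mono mult_mono) (auto simp: dist_norm)
    finally show "dist (prod (f x) (g x)) (prod (f y) (g y)) \<le> (A * M * K + L * B * K) * dist x y"
      by (simp add: dist_norm algebra_simps)
  qed (use A B K L M in simp)
  then show ?thesis by blast
qed

lemma lipschitz_on_linear:
  fixes f :: "'a::real_normed_vector \<Rightarrow> 'b::real_normed_vector"
    and T :: "'b \<Rightarrow> 'd::real_normed_vector"
  assumes "bounded_linear T" "L-lipschitz_on S f"
  shows "\<exists>K. K-lipschitz_on S (\<lambda>x. T (f x))"
proof -
  obtain B where "B-lipschitz_on (f ` S) T"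
    using bounded_linear.lipschitz_boundE[OF assms(1)] by blast
  then show ?thesis using lipschitz_on_compose2[OF assms(2)] by blast
qed

section \<open>Closure properties of the two regularity classes\<close>

lemma C11_onI:
  assumes "\<And>x. x \<in> S \<Longrightarrow> (f has_derivative blinfun_apply (f' x)) (at x within S)"
    and "L-lipschitz_on S f'"
  shows "C11_on S f"
  using assms unfolding C11_on_def by blast

lemma C21_onI:
  assumes "\<And>x. x \<in> S \<Longrightarrow> (f has_derivative blinfun_apply (f' x)) (at x within S)"
    and "C11_on S f'"
  shows "C21_on S f"
  using assms unfolding C21_on_def by blast

text \<open>A Lipschitz derivative is bounded on a bounded set, and the mean value inequality on a
  convex set turns this bound into a Lipschitz constant. The product and chain rules below rest on
  it.\<close>

lemma C11_on_lipschitz: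
  assumes "convex S" "bounded S" "C11_on S f"
  obtains L where "L-lipschitz_on S f"
proof -
  obtain f' L where f': "\<And>x. x \<in> S \<Longrightarrow> (f has_derivative blinfun_apply (f' x)) (at x within S)"
    and L: "L-lipschitz_on S f'"
    using assms(3) unfolding C11_on_def by blast
  obtain B where B: "B > 0" "\<And>x. x \<in> S \<Longrightarrow> norm (f' x) \<le> B"
    using lipschitz_on_bounded_norm[OF assms(2) L] by blast
  have "B-lipschitz_on S f"
  proof (rule lipschitz_onI)
    fix x y assume x: "x \<in> S" and y: "y \<in> S"
    show "dist (f x) (f y) \<le> B * dist x y" unfolding dist_norm
      by (rule differentiable_bound[OF assms(1) f' _ x y])
        (use B in \<open>auto simp: norm_blinfun.rep_eq\<close>)
  qed (use B in simp)
  then show ?thesis by (rule that)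
qed

lemma C11_on_cong:
  assumes "C11_on S f" "\<And>x. x \<in> S \<Longrightarrow> f x = g x"
  shows "C11_on S g"
proof -
  obtain f' where "\<And>x. x \<in> S \<Longrightarrow> (f has_derivative blinfun_apply (f' x)) (at x within S)"
    "\<exists>L. L-lipschitz_on S f'" using assms(1) unfolding C11_on_def by blast
  then show ?thesis unfolding C11_on_def
    using assms(2) by (intro exI[of _ f']) (auto intro: has_derivative_transform[of _ S g f])
qed

lemma C21_on_cong:
  assumes "C21_on S f" "\<And>x. x \<in> S \<Longrightarrow> f x = g x"
  shows "C21_on S g"
proof -
  obtain f' where "\<And>x. x \<in> S \<Longrightarrow> (f has_derivative blinfun_apply (f' x)) (at x within S)"
    "C11_on S f'" using assms(1) unfolding C21_on_def by blast
  then show ?thesis unfolding C21_on_def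
    using assms(2) by (intro exI[of _ f']) (auto intro: has_derivative_transform[of _ S g f])
qed

lemma C21_on_imp_C11_on:
  assumes "convex S" "bounded S" "C21_on S f"
  shows "C11_on S f"
proof -
  obtain f' where f: "\<And>x. x \<in> S \<Longrightarrow> (f has_derivative blinfun_apply (f' x)) (at x within S)"
    and f': "C11_on S f'" using assms(3) unfolding C21_on_def by blast
  obtain L where "L-lipschitz_on S f'" using C11_on_lipschitz[OF assms(1,2) f'] .
  then show ?thesis unfolding C11_on_def using f by blast
qed

lemma C11_on_linear: "bounded_linear T \<Longrightarrow> C11_on S T"
  unfolding C11_on_def
  by (rule exI[of _ "\<lambda>_. Blinfun T"])
    (auto simp: bounded_linear_Blinfun_apply bounded_linear_imp_has_derivative
      intro!: exI[of _ 0] lipschitz_on_constant)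

lemma C11_on_const: "C11_on S (\<lambda>_. c)"
  unfolding C11_on_def
  by (rule exI[of _ "\<lambda>_. 0"])
    (auto simp: zero_blinfun.rep_eq intro!: exI[of _ 0] lipschitz_on_constant)

lemma C21_on_linear: "bounded_linear T \<Longrightarrow> C21_on S T"
  unfolding C21_on_def
  by (rule exI[of _ "\<lambda>_. Blinfun T"])
    (auto simp: bounded_linear_Blinfun_apply bounded_linear_imp_has_derivative C11_on_const)

lemma C21_on_const: "C21_on S (\<lambda>_. c)"
  unfolding C21_on_def
  by (rule exI[of _ "\<lambda>_. 0"]) (auto simp: C11_on_const zero_blinfun.rep_eq)

lemma C11_on_add:
  assumes "C11_on S f" "C11_on S g"
  shows "C11_on S (\<lambda>x. f x + g x)"
proof -
  obtain f' L where "\<And>x. x \<in> S \<Longrightarrow> (f has_derivative blinfun_apply (f' x)) (at x within S)"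
    "L-lipschitz_on S f'" using assms(1) unfolding C11_on_def by blast
  moreover obtain g' M where "\<And>x. x \<in> S \<Longrightarrow> (g has_derivative blinfun_apply (g' x)) (at x within S)"
    "M-lipschitz_on S g'" using assms(2) unfolding C11_on_def by blast
  ultimately show ?thesis unfolding C11_on_def
    by (intro exI[of _ "\<lambda>x. f' x + g' x"])
      (auto simp: plus_blinfun.rep_eq intro!: has_derivative_add lipschitz_on_add exI[of _ "L + M"])
qed

lemma C21_on_add:
  assumes "C21_on S f" "C21_on S g"
  shows "C21_on S (\<lambda>x. f x + g x)"
proof -
  obtain f' where "\<And>x. x \<in> S \<Longrightarrow> (f has_derivative blinfun_apply (f' x)) (at x within S)"
    "C11_on S f'" using assms(1) unfolding C21_on_def by blast
  moreover obtain g' where "\<And>x. x \<in> S \<Longrightarrow> (g has_derivative blinfun_apply (g' x)) (at x within S)"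
    "C11_on S g'" using assms(2) unfolding C21_on_def by blast
  ultimately show ?thesis unfolding C21_on_def
    by (intro exI[of _ "\<lambda>x. f' x + g' x"])
      (auto simp: plus_blinfun.rep_eq intro!: has_derivative_add C11_on_add)
qed

lemma C11_on_compose:
  assumes "convex S" "bounded S" "convex T" "bounded T"
    and "C11_on T g" "C11_on S f" "f ` S \<subseteq> T"
  shows "C11_on S (\<lambda>x. g (f x))"
proof -
  obtain f' L where f: "\<And>x. x \<in> S \<Longrightarrow> (f has_derivative blinfun_apply (f' x)) (at x within S)"
    and L: "L-lipschitz_on S f'" using assms(6) unfolding C11_on_def by blast
  obtain g' M where g: "\<And>x. x \<in> T \<Longrightarrow> (g has_derivative blinfun_apply (g' x)) (at x within T)"
    and M: "M-lipschitz_on T g'" using assms(5) unfolding C11_on_def by blast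
  obtain N where "N-lipschitz_on S f" using C11_on_lipschitz assms by metis
  then have "(M * N)-lipschitz_on S (\<lambda>x. g' (f x))"
    using lipschitz_on_compose2 lipschitz_on_subset[OF M assms(7)] by blast
  then obtain K where "K-lipschitz_on S (\<lambda>x. g' (f x) o\<^sub>L f' x)"
    using lipschitz_on_bilinear[OF bounded_bilinear_blinfun_compose assms(2) _ L] by blast
  moreover have "((\<lambda>x. g (f x)) has_derivative blinfun_apply (g' (f x) o\<^sub>L f' x)) (at x within S)"
    if "x \<in> S" for x
    using has_derivative_in_compose[OF f[OF that] has_derivative_subset[OF g assms(7)]] that assms(7)
    by (auto simp: blinfun_compose.rep_eq o_def image_subset_iff)
  ultimately show ?thesis by (intro C11_onI)
qed

lemma C11_on_bilinear:
  fixes f :: "'a::real_normed_vector \<Rightarrow> 'b::real_normed_vector"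
    and g :: "'a \<Rightarrow> 'c::real_normed_vector"
    and prod :: "'b \<Rightarrow> 'c \<Rightarrow> 'd::real_normed_vector"
  assumes "bounded_bilinear prod" "convex S" "bounded S" "C11_on S f" "C11_on S g"
  shows "C11_on S (\<lambda>x. prod (f x) (g x))"
proof -
  interpret bounded_bilinear prod by fact
  obtain f' L where f: "\<And>x. x \<in> S \<Longrightarrow> (f has_derivative blinfun_apply (f' x)) (at x within S)"
    and L: "L-lipschitz_on S f'" using assms(4) unfolding C11_on_def by blast
  obtain g' M where g: "\<And>x. x \<in> S \<Longrightarrow> (g has_derivative blinfun_apply (g' x)) (at x within S)"
    and M: "M-lipschitz_on S g'" using assms(5) unfolding C11_on_def by blast
  obtain A where A: "A-lipschitz_on S f" using C11_on_lipschitz assms by metis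
  obtain B where B: "B-lipschitz_on S g" using C11_on_lipschitz assms by metis
  obtain A' where A': "A'-lipschitz_on S (\<lambda>x. prod_right (f x))"
    using lipschitz_on_linear[OF bounded_linear_prod_right A] by blast
  obtain B' where B': "B'-lipschitz_on S (\<lambda>x. prod_left (g x))"
    using lipschitz_on_linear[OF bounded_linear_prod_left B] by blast
  obtain C where C: "C-lipschitz_on S (\<lambda>x. prod_right (f x) o\<^sub>L g' x)"
    using lipschitz_on_bilinear[OF bounded_bilinear_blinfun_compose assms(3) A' M] by blast
  obtain D where D: "D-lipschitz_on S (\<lambda>x. prod_left (g x) o\<^sub>L f' x)"
    using lipschitz_on_bilinear[OF bounded_bilinear_blinfun_compose assms(3) B' L] by blast
  show ?thesis unfolding C11_on_def
  proof (intro exI[of _ "\<lambda>x. (prod_right (f x) o\<^sub>L g' x) + (prod_left (g x) o\<^sub>L f' x)"] conjI ballI)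
    show "\<exists>L. L-lipschitz_on S (\<lambda>x. (prod_right (f x) o\<^sub>L g' x) + (prod_left (g x) o\<^sub>L f' x))"
      using lipschitz_on_add[OF C D] by blast
    fix x assume x: "x \<in> S"
    show "((\<lambda>x. prod (f x) (g x)) has_derivative
        blinfun_apply ((prod_right (f x) o\<^sub>L g' x) + (prod_left (g x) o\<^sub>L f' x))) (at x within S)"
      using FDERIV[OF f[OF x] g[OF x]]
      by (simp add: plus_blinfun.rep_eq blinfun_compose.rep_eq prod_right.rep_eq prod_left.rep_eq o_def)
  qed
qed

lemma C11_on_linear_compose:
  assumes "bounded_linear T" "C11_on S f"
  shows "C11_on S (\<lambda>x. T (f x))"
proof -
  obtain f' L where f: "\<And>x. x \<in> S \<Longrightarrow> (f has_derivative blinfun_apply (f' x)) (at x within S)"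
    and L: "L-lipschitz_on S f'" using assms(2) unfolding C11_on_def by blast
  obtain K where "K-lipschitz_on S (\<lambda>x. Blinfun T o\<^sub>L f' x)"
    using lipschitz_on_linear[OF _ L, of "\<lambda>h. Blinfun T o\<^sub>L h"]
      bounded_bilinear.bounded_linear_right[OF bounded_bilinear_blinfun_compose] by blast
  moreover have "((\<lambda>x. T (f x)) has_derivative blinfun_apply (Blinfun T o\<^sub>L f' x)) (at x within S)"
    if "x \<in> S" for x
    using bounded_linear.has_derivative[OF assms(1) f[OF that]]
    by (simp add: blinfun_compose.rep_eq o_def bounded_linear_Blinfun_apply[OF assms(1)])
  ultimately show ?thesis by (intro C11_onI)
qed

lemma C21_on_bilinear:
  fixes f :: "'a::real_normed_vector \<Rightarrow> 'b::real_normed_vector"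
    and g :: "'a \<Rightarrow> 'c::real_normed_vector"
    and prod :: "'b \<Rightarrow> 'c \<Rightarrow> 'd::real_normed_vector"
  assumes "bounded_bilinear prod" "convex S" "bounded S" "C21_on S f" "C21_on S g"
  shows "C21_on S (\<lambda>x. prod (f x) (g x))"
proof -
  interpret bounded_bilinear prod by fact
  obtain f' where f: "\<And>x. x \<in> S \<Longrightarrow> (f has_derivative blinfun_apply (f' x)) (at x within S)"
    and f': "C11_on S f'" using assms(4) unfolding C21_on_def by blast
  obtain g' where g: "\<And>x. x \<in> S \<Longrightarrow> (g has_derivative blinfun_apply (g' x)) (at x within S)"
    and g': "C11_on S g'" using assms(5) unfolding C21_on_def by blast
  have "C11_on S f" "C11_on S g" by (rule C21_on_imp_C11_on[OF assms(2,3)], fact)+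
  then have "C11_on S (\<lambda>x. prod_right (f x))" "C11_on S (\<lambda>x. prod_left (g x))"
    using C11_on_linear_compose bounded_linear_prod_right bounded_linear_prod_left by blast+
  then have "C11_on S (\<lambda>x. (prod_right (f x) o\<^sub>L g' x) + (prod_left (g x) o\<^sub>L f' x))"
    by (intro C11_on_add C11_on_bilinear[OF bounded_bilinear_blinfun_compose] assms f' g')
  moreover have "((\<lambda>x. prod (f x) (g x)) has_derivative
        blinfun_apply ((prod_right (f x) o\<^sub>L g' x) + (prod_left (g x) o\<^sub>L f' x))) (at x within S)"
    if x: "x \<in> S" for x
    using FDERIV[OF f[OF x] g[OF x]]
    by (simp add: plus_blinfun.rep_eq blinfun_compose.rep_eq prod_right.rep_eq prod_left.rep_eq o_def)
  ultimately show ?thesis by (intro C21_onI)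
qed

lemma C21_on_compose:
  assumes "convex S" "bounded S" "convex T" "bounded T"
    and "C21_on T g" "C21_on S f" "f ` S \<subseteq> T"
  shows "C21_on S (\<lambda>x. g (f x))"
proof -
  obtain f' where f: "\<And>x. x \<in> S \<Longrightarrow> (f has_derivative blinfun_apply (f' x)) (at x within S)"
    and f': "C11_on S f'" using assms(6) unfolding C21_on_def by blast
  obtain g' where g: "\<And>x. x \<in> T \<Longrightarrow> (g has_derivative blinfun_apply (g' x)) (at x within T)"
    and g': "C11_on T g'" using assms(5) unfolding C21_on_def by blast
  have "C11_on S (\<lambda>x. g' (f x))"
    by (rule C11_on_compose[OF assms(1-4) g' C21_on_imp_C11_on[OF assms(1,2,6)] assms(7)])
  then have "C11_on S (\<lambda>x. g' (f x) o\<^sub>L f' x)"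
    by (intro C11_on_bilinear[OF bounded_bilinear_blinfun_compose] assms f')
  moreover have "((\<lambda>x. g (f x)) has_derivative blinfun_apply (g' (f x) o\<^sub>L f' x)) (at x within S)"
    if "x \<in> S" for x
    using has_derivative_in_compose[OF f[OF that] has_derivative_subset[OF g assms(7)]] that assms(7)
    by (auto simp: blinfun_compose.rep_eq o_def image_subset_iff)
  ultimately show ?thesis by (intro C21_onI)
qed

text \<open>The resolvent identity: it expresses the difference of two inverses by the difference of
  the operators, and so carries both Lipschitz bounds and derivatives over to inverses.\<close>

lemma blinfun_inverse_diff:
  assumes "Q o\<^sub>L B = id_blinfun" "A o\<^sub>L P = id_blinfun"
  shows "Q o\<^sub>L ((B - A) o\<^sub>L P) = P - Q"
  using arg_cong[OF assms(1), of blinfun_apply] arg_cong[OF assms(2), of blinfun_apply]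
  by (intro blinfun_eqI) (simp add: blinfun.bilinear_simps fun_eq_iff blinfun_compose.rep_eq)

lemma lipschitz_on_blinfun_inverse:
  fixes A :: "'a::real_normed_vector \<Rightarrow> 'b::real_normed_vector \<Rightarrow>\<^sub>L 'c::real_normed_vector"
  assumes N: "N-lipschitz_on S A"
    and PA: "\<And>x. x \<in> S \<Longrightarrow> P x o\<^sub>L A x = id_blinfun"
    and AP: "\<And>x. x \<in> S \<Longrightarrow> A x o\<^sub>L P x = id_blinfun"
    and B: "\<And>x. x \<in> S \<Longrightarrow> norm (P x) \<le> B"
  shows "\<exists>M. M-lipschitz_on S P"
proof -
  have "(B * N * B)-lipschitz_on S P" if "S \<noteq> {}"
  proof -
    have B0: "B \<ge> 0" using that B norm_ge_zero order_trans by blast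
    show ?thesis
    proof (rule lipschitz_onI)
      fix x y assume x: "x \<in> S" and y: "y \<in> S"
      have "norm (P x - P y) \<le> norm (P y) * (norm (A y - A x) * norm (P x))"
        unfolding blinfun_inverse_diff[OF PA[OF y] AP[OF x], symmetric]
        by (rule order_trans[OF norm_blinfun_compose mult_left_mono[OF norm_blinfun_compose norm_ge_zero]])
      also have "\<dots> \<le> B * ((N * dist y x) * B)"
        using B x y B0 lipschitz_onD[OF N y x] lipschitz_on_nonneg[OF N]
        by (intro mult_mono) (auto simp: dist_norm)
      finally show "dist (P x) (P y) \<le> B * N * B * dist x y"
        by (simp add: dist_norm dist_commute norm_minus_commute algebra_simps)
    qed (use B0 lipschitz_on_nonneg[OF N] in simp)
  qed
  \<comment> \<open>On the empty set nothing forces \<open>B\<close> to be nonnegative, so that case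
    is treated apart.\<close>
  then show ?thesis by (metis lipschitz_on_empty_iff order_refl)
qed

text \<open>By the resolvent identity, \<open>P y\<close> equals \<open>P x\<close> minus the
  product of \<open>P y\<close> with \<open>R y\<close>, where \<open>R\<close> vanishes at
  \<open>x\<close>. Hence the derivative of \<open>P\<close> at \<open>x\<close> follows from that
  of \<open>R\<close> and the Lipschitz bound for \<open>P\<close>; the differentiability of
  \<open>P\<close> is not presupposed.\<close>

lemma C11_on_blinfun_inverse:
  fixes A :: "'a::real_normed_vector \<Rightarrow> 'b::real_normed_vector \<Rightarrow>\<^sub>L 'c::real_normed_vector"
  assumes "convex S" "bounded S" "C11_on S A"
    and PA: "\<And>x. x \<in> S \<Longrightarrow> P x o\<^sub>L A x = id_blinfun"
    and AP: "\<And>x. x \<in> S \<Longrightarrow> A x o\<^sub>L P x = id_blinfun"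
    and B: "\<And>x. x \<in> S \<Longrightarrow> norm (P x) \<le> B"
  shows "C11_on S P"
proof -
  note bl = bounded_bilinear_blinfun_compose
  obtain A' L where A: "\<And>x. x \<in> S \<Longrightarrow> (A has_derivative blinfun_apply (A' x)) (at x within S)"
    and L: "L-lipschitz_on S A'" using assms(3) unfolding C11_on_def by blast
  obtain N where N: "N-lipschitz_on S A" using C11_on_lipschitz assms by metis
  note id = blinfun_inverse_diff[OF PA AP]
  obtain M where M: "M-lipschitz_on S P" using lipschitz_on_blinfun_inverse[OF N PA AP B] by blast
  define PL :: "'a \<Rightarrow> ('b \<Rightarrow>\<^sub>L 'c) \<Rightarrow>\<^sub>L ('c \<Rightarrow>\<^sub>L 'c)"
    where "PL x = bounded_bilinear.prod_left (o\<^sub>L) (P x)" for x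
  define PR :: "'a \<Rightarrow> ('c \<Rightarrow>\<^sub>L 'c) \<Rightarrow>\<^sub>L ('c \<Rightarrow>\<^sub>L 'b)"
    where "PR x = bounded_bilinear.prod_right (o\<^sub>L) (P x)" for x
  \<comment> \<open>The map sending h to - P A'(h) P, built from left and right multiplication
    operators so that its Lipschitz bound follows from products.\<close>
  define T where "T x = - (PR x o\<^sub>L (PL x o\<^sub>L A' x))" for x
  have T: "T x h = - (P x o\<^sub>L (A' x h o\<^sub>L P x))" for x h
    by (simp add: T_def PL_def PR_def uminus_blinfun.rep_eq blinfun.bilinear_simps
        bounded_bilinear.prod_right.rep_eq[OF bl] bounded_bilinear.prod_left.rep_eq[OF bl])
  show ?thesis unfolding C11_on_def
  proof (intro exI[of _ T] conjI ballI)
    obtain K1 K2 where K1: "K1-lipschitz_on S (\<lambda>x. PR x)"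
      and K2: "K2-lipschitz_on S (\<lambda>x. PL x)"
      using lipschitz_on_linear[OF bounded_bilinear.bounded_linear_prod_right[OF bl] M]
        lipschitz_on_linear[OF bounded_bilinear.bounded_linear_prod_left[OF bl] M]
      unfolding PL_def PR_def by blast
    from lipschitz_on_bilinear[OF bl assms(2) K2 L] obtain K3 where
      K3: "K3-lipschitz_on S (\<lambda>x. PL x o\<^sub>L A' x)" ..
    show "\<exists>L. L-lipschitz_on S T"
      unfolding T_def lipschitz_on_minus_iff by (rule lipschitz_on_bilinear[OF bl assms(2) K1 K3])
    fix x assume x: "x \<in> S"
    define R where "R y = (A y - A x) o\<^sub>L P x" for y
    have R: "(R has_derivative (\<lambda>h. A' x h o\<^sub>L P x)) (at x within S)"
      unfolding R_def
      using bounded_linear.has_derivative[OF bounded_bilinear.bounded_linear_left[OF bl]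
          has_derivative_diff[OF A[OF x] has_derivative_const]] by simp
    have "((\<lambda>y. P y o\<^sub>L R y) has_derivative (\<lambda>h. P x o\<^sub>L (A' x h o\<^sub>L P x))) (at x within S)"
    proof -
      have *: "(\<lambda>y. P y o\<^sub>L R y) = (\<lambda>y. ((P y - P x) o\<^sub>L R y) + (P x o\<^sub>L R y))"
        by (simp add: bounded_bilinear.diff_left[OF bl] fun_eq_iff)
      have "((\<lambda>y. P x o\<^sub>L R y) has_derivative (\<lambda>h. P x o\<^sub>L (A' x h o\<^sub>L P x))) (at x within S)"
        by (rule bounded_linear.has_derivative[OF bounded_bilinear.bounded_linear_right[OF bl] R])
      \<comment> \<open>Both factors are Lipschitz and vanish at \<open>x\<close>, so this term is
        quadratic in \<open>y - x\<close>.\<close>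
      moreover have "((\<lambda>y. (P y - P x) o\<^sub>L R y) has_derivative (\<lambda>h. 0)) (at x within S)"
      proof -
        have Rx: "R x = 0" by (simp add: R_def)
        obtain k where k: "k-lipschitz_on S R"
        proof -
          obtain k where "k-lipschitz_on S (\<lambda>y. A y o\<^sub>L P x)"
            using lipschitz_on_linear[OF bounded_bilinear.bounded_linear_left[OF bl] N] by blast
          then have "k-lipschitz_on S R"
            unfolding R_def bounded_bilinear.diff_left[OF bl] lipschitz_on_def by (simp add: dist_norm)
          then show ?thesis by (rule that)
        qed
        have bnd: "norm ((P y - P x) o\<^sub>L R y) \<le> M * k * (norm (y - x) * norm (y - x))" if y: "y \<in> S" for y
        proof -
          have "norm ((P y - P x) o\<^sub>L R y) \<le> norm (P y - P x) * norm (R y - R x)"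
            using norm_blinfun_compose Rx by auto
          also have "\<dots> \<le> (M * norm (y - x)) * (k * norm (y - x))"
            using lipschitz_onD[OF M y x] lipschitz_onD[OF k y x] lipschitz_on_nonneg[OF M]
            by (intro mult_mono) (auto simp: dist_norm)
          finally show ?thesis by (simp add: algebra_simps)
        qed
        show ?thesis unfolding has_derivative_within
        proof (intro conjI bounded_linear_zero)
          have lim: "((\<lambda>y. M * k * norm (y - x)) \<longlongrightarrow> 0) (at x within S)"
            by (auto intro!: tendsto_eq_intros)
          show "((\<lambda>y. (1 / norm (y - x)) *\<^sub>R
             (((P y - P x) o\<^sub>L R y) - (((P x - P x) o\<^sub>L R x) + 0))) \<longlongrightarrow> 0) (at x within S)"
          proof (rule Lim_null_comparison[OF _ lim])
            show "\<forall>\<^sub>F y in at x within S. norm ((1 / norm (y - x)) *\<^sub>R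
             (((P y - P x) o\<^sub>L R y) - (((P x - P x) o\<^sub>L R x) + 0))) \<le> M * k * norm (y - x)"
              unfolding eventually_at_topological
              by (rule exI[of _ UNIV]) (use bnd in \<open>auto simp: Rx divide_simps mult.assoc\<close>)
          qed
        qed
      qed
      ultimately show ?thesis unfolding * using has_derivative_add by fastforce
    qed
    then have "((\<lambda>y. P x - (P y o\<^sub>L R y)) has_derivative (\<lambda>h. 0 - (P x o\<^sub>L (A' x h o\<^sub>L P x)))) (at x within S)"
      by (intro has_derivative_diff has_derivative_const)
    moreover have "blinfun_apply (T x) = (\<lambda>h. 0 - (P x o\<^sub>L (A' x h o\<^sub>L P x)))" using T by auto
    ultimately have "((\<lambda>y. P x - (P y o\<^sub>L R y)) has_derivative blinfun_apply (T x)) (at x within S)"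
      by simp
    then show "(P has_derivative blinfun_apply (T x)) (at x within S)"
      by (rule has_derivative_transform[OF x, rotated]) (simp add: R_def id[OF _ x])
  qed
qed

subsection \<open>Inverse maps and perturbations of the identity\<close>

lemma lipschitz_on_local:
  fixes f :: "'a::euclidean_space \<Rightarrow> 'b::real_normed_vector"
  assumes "compact S" and loc: "\<And>x. x \<in> S \<Longrightarrow> \<exists>e>0. \<exists>L. L-lipschitz_on (ball x e) f"
  shows "\<exists>L. L-lipschitz_on S f"
proof -
  \<comment> \<open>\<open>local_lipschitz\<close> speaks of families indexed by time; here the only
    time is 0.\<close>
  have "local_lipschitz {0::real} S (\<lambda>_. f)"
  proof (rule local_lipschitzI)
    fix t :: real and x assume "x \<in> S"
    then obtain e L where "e > 0" "L-lipschitz_on (ball x e) f" using loc by blast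
    then show "\<exists>u>0. \<exists>L. \<forall>t\<in>cball t u \<inter> {0}. L-lipschitz_on (cball x u \<inter> S) f"
      by (intro exI[of _ "e/2"] conjI exI[of _ L]) (auto intro: lipschitz_on_subset)
  qed
  from local_lipschitz_compact_implies_lipschitz[OF this assms(1)] show ?thesis by auto
qed

text \<open>Derivatives on an open ball are unique, so derivatives chosen separately on many balls
  patch together to the Frechet derivative. In the next two lemmas the balls may leave
  \<open>S\<close>, which keeps this uniqueness at boundary points of \<open>S\<close>.\<close>

lemma Blinfun_frechet_derivative_eq:
  assumes "\<And>y. y \<in> ball x e \<Longrightarrow> (f has_derivative blinfun_apply (D y)) (at y within ball x e)"
    and "y \<in> ball x e"
  shows "Blinfun (frechet_derivative f (at y)) = D y"
proof -
  have "(f has_derivative blinfun_apply (D y)) (at y)"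
    using assms at_within_open[of y "ball x e"] by fastforce
  then show ?thesis by (metis blinfun_apply_inverse frechet_derivative_at)
qed

lemma C11_on_local:
  fixes f :: "'a::euclidean_space \<Rightarrow> 'b::real_normed_vector"
  assumes "compact S" and loc: "\<And>x. x \<in> S \<Longrightarrow> \<exists>e>0. C11_on (ball x e) f"
  shows "C11_on S f"
proof -
  define f' where "f' x = Blinfun (frechet_derivative f (at x))" for x
  note 1 = Blinfun_frechet_derivative_eq[of _ _ f, folded f'_def]
  have "\<exists>L. L-lipschitz_on S f'"
  proof (rule lipschitz_on_local[OF assms(1)])
    fix x assume "x \<in> S"
    then obtain e D L where e: "e > 0" and D: "\<And>y. y \<in> ball x e \<Longrightarrow>
        (f has_derivative blinfun_apply (D y)) (at y within ball x e)" and "L-lipschitz_on (ball x e) D"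
      using loc unfolding C11_on_def by blast
    then have "L-lipschitz_on (ball x e) f'"
      using lipschitz_on_transform[of L "ball x e" D f'] 1[OF D] by simp
    with e show "\<exists>e>0. \<exists>L. L-lipschitz_on (ball x e) f'" by blast
  qed
  moreover have "(f has_derivative blinfun_apply (f' x)) (at x within S)" if x: "x \<in> S" for x
  proof -
    obtain e D where e: "e > 0" and D: "\<And>y. y \<in> ball x e \<Longrightarrow>
        (f has_derivative blinfun_apply (D y)) (at y within ball x e)"
      using loc[OF x] unfolding C11_on_def by blast
    then have "(f has_derivative blinfun_apply (f' x)) (at x within ball x e)"
      using 1[OF D] by simp
    then have "(f has_derivative blinfun_apply (f' x)) (at x)"
      using e by (simp add: at_within_open[of x "ball x e"])
    then show ?thesis by (rule has_derivative_at_withinI)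
  qed
  ultimately show ?thesis unfolding C11_on_def by blast
qed

lemma C21_on_local:
  fixes f :: "'a::euclidean_space \<Rightarrow> 'b::real_normed_vector"
  assumes "compact S" and loc: "\<And>x. x \<in> S \<Longrightarrow> \<exists>e>0. C21_on (ball x e) f"
  shows "C21_on S f"
proof -
  define f' where "f' x = Blinfun (frechet_derivative f (at x))" for x
  note 1 = Blinfun_frechet_derivative_eq[of _ _ f, folded f'_def]
  have "C11_on S f'"
  proof (rule C11_on_local[OF assms(1)])
    fix x assume "x \<in> S"
    then obtain e D where e: "e > 0" and D: "\<And>y. y \<in> ball x e \<Longrightarrow>
        (f has_derivative blinfun_apply (D y)) (at y within ball x e)" and "C11_on (ball x e) D"
      using loc unfolding C21_on_def by blast
    then have "C11_on (ball x e) f'"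
      using C11_on_cong[of "ball x e" D f'] 1[OF D] by simp
    with e show "\<exists>e>0. C11_on (ball x e) f'" by blast
  qed
  moreover have "(f has_derivative blinfun_apply (f' x)) (at x within S)" if x: "x \<in> S" for x
  proof -
    obtain e D where e: "e > 0" and D: "\<And>y. y \<in> ball x e \<Longrightarrow>
        (f has_derivative blinfun_apply (D y)) (at y within ball x e)"
      using loc[OF x] unfolding C21_on_def by blast
    then have "(f has_derivative blinfun_apply (f' x)) (at x within ball x e)"
      using 1[OF D] by simp
    then have "(f has_derivative blinfun_apply (f' x)) (at x)"
      using e by (simp add: at_within_open[of x "ball x e"])
    then show ?thesis by (rule has_derivative_at_withinI)
  qed
  ultimately show ?thesis unfolding C21_on_def by blast
qed

text \<open>With w = \<open>v z\<close>, the error of \<open>v\<close> at \<open>f x\<close> is -Q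
  applied to the error of \<open>f\<close> at \<open>x\<close> for the increment w - x, and the
  Lipschitz bound on \<open>v\<close> compares w - x with \<open>z - f x\<close>.\<close>

lemma has_derivative_inverse_within:
  fixes f :: "'a::real_normed_vector \<Rightarrow> 'b::real_normed_vector"
  assumes "(f has_derivative A) (at x within S)" "x \<in> S" "bounded_linear Q"
    and QA: "\<And>h. Q (A h) = h"
    and "K-lipschitz_on T v" "v ` T \<subseteq> S"
    and vf: "v (f x) = x" "f x \<in> T" and fv: "\<And>y. y \<in> T \<Longrightarrow> f (v y) = y"
  shows "(v has_derivative Q) (at (f x) within T)"
  unfolding has_derivative_within_alt
proof (intro conjI allI impI)
  show "bounded_linear Q" by fact
  interpret Q: bounded_linear Q by fact
  obtain q where q: "q > 0" "\<And>h. norm (Q h) \<le> norm h * q" using Q.pos_bounded by blast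
  have K0: "K \<ge> 0" using assms(5) lipschitz_on_nonneg by blast
  \<comment> \<open>\<open>K\<close> may be 0, and a positive constant is needed as a
    divisor.\<close>
  define k where "k = K + 1"
  have k: "k > 0" using K0 by (simp add: k_def)
  have kl: "norm (v z - v y) \<le> k * norm (z - y)" if "z \<in> T" "y \<in> T" for z y
    using lipschitz_onD[OF assms(5) that] mult_right_mono[of K k "norm (z - y)"]
    by (simp add: dist_norm k_def)
  fix e :: real assume e: "e > 0"
  define e' where "e' = e / (q * k)"
  have e': "e' > 0" using e q k by (simp add: e'_def)
  from assms(1) e' obtain d where d: "d > 0" "\<And>w. w \<in> S \<Longrightarrow> norm (w - x) < d \<Longrightarrow>
      norm (f w - f x - A (w - x)) \<le> e' * norm (w - x)"
    unfolding has_derivative_within_alt by blast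
  show "\<exists>d>0. \<forall>z\<in>T. norm (z - f x) < d \<longrightarrow> norm (v z - v (f x) - Q (z - f x)) \<le> e * norm (z - f x)"
  proof (intro exI[of _ "d / k"] conjI ballI impI)
    show "d / k > 0" using d k by simp
    fix z assume z: "z \<in> T" and zd: "norm (z - f x) < d / k"
    have a: "norm (v z - x) \<le> k * norm (z - f x)" using kl[OF z vf(2)] vf(1) by simp
    also have "\<dots> < d" using zd k by (simp add: field_simps)
    finally have b: "norm (z - f x - A (v z - x)) \<le> e' * norm (v z - x)"
      using d(2)[of "v z"] z assms(6) fv[OF z] by auto
    have "v z - v (f x) - Q (z - f x) = - Q (z - f x - A (v z - x))"
      by (simp add: Q.diff QA vf(1))
    then have "norm (v z - v (f x) - Q (z - f x)) \<le> norm (z - f x - A (v z - x)) * q"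
      using q(2) by simp
    also have "\<dots> \<le> (e' * (k * norm (z - f x))) * q"
      using b a e' q(1) by (smt (verit) mult_left_mono mult_right_mono)
    also have "\<dots> = e * norm (z - f x)" using q k by (simp add: e'_def)
    finally show "norm (v z - v (f x) - Q (z - f x)) \<le> e * norm (z - f x)" .
  qed
qed

text \<open>A bootstrap through the formula v' = Q o v. Since \<open>v\<close> is Lipschitz, so is Q
  o v, hence \<open>v\<close> is C^{1,1}; then A o v is C^{1,1}, so is its pointwise inverse Q o v,
  and \<open>v\<close> is C^{2,1}.\<close>

lemma C21_on_inverse:
  assumes "convex S" "bounded S" "convex T" "bounded T"
    and f: "\<And>x. x \<in> S \<Longrightarrow> (f has_derivative blinfun_apply (A x)) (at x within S)" and A: "C11_on S A"
    and QA: "\<And>x. x \<in> S \<Longrightarrow> Q x o\<^sub>L A x = id_blinfun"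
    and AQ: "\<And>x. x \<in> S \<Longrightarrow> A x o\<^sub>L Q x = id_blinfun"
    and B: "\<And>x. x \<in> S \<Longrightarrow> norm (Q x) \<le> B"
    and v: "K-lipschitz_on T v" "v ` T \<subseteq> S" "f ` S \<subseteq> T"
    and vf: "\<And>x. x \<in> S \<Longrightarrow> v (f x) = x" and fv: "\<And>y. y \<in> T \<Longrightarrow> f (v y) = y"
  shows "C21_on T v"
proof -
  have vS: "v y \<in> S" if "y \<in> T" for y using that v(2) by blast
  have der: "(v has_derivative blinfun_apply (Q (v y))) (at y within T)" if y: "y \<in> T" for y
  proof -
    have *: "blinfun_apply (Q (v y)) (blinfun_apply (A (v y)) h) = h" for h
      using arg_cong[OF QA[OF vS[OF y]], of "\<lambda>F. blinfun_apply F h"] by simp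
    have "(v has_derivative blinfun_apply (Q (v y))) (at (f (v y)) within T)"
      by (rule has_derivative_inverse_within[OF f[OF vS[OF y]] vS[OF y]
          blinfun.bounded_linear_right * v(1,2)]) (use y fv vf in auto)
    then show ?thesis by (simp add: fv[OF y])
  qed
  obtain N where N: "N-lipschitz_on S A" using C11_on_lipschitz[OF assms(1,2) A] .
  have "(N * K)-lipschitz_on T (\<lambda>y. A (v y))"
    using lipschitz_on_compose2[OF v(1) lipschitz_on_subset[OF N v(2)]] .
  then have "\<exists>M. M-lipschitz_on T (\<lambda>y. Q (v y))"
    by (rule lipschitz_on_blinfun_inverse) (use QA AQ B vS in auto)
  then obtain M where "M-lipschitz_on T (\<lambda>y. Q (v y))" ..
  with der have "C11_on T v" by (rule C11_onI)
  then have "C11_on T (\<lambda>y. A (v y))"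
    by (rule C11_on_compose[OF assms(3,4,1,2) A _ v(2)])
  then have "C11_on T (\<lambda>y. Q (v y))"
    by (rule C11_on_blinfun_inverse[OF assms(3,4)]) (use QA AQ B vS in auto)
  with der show ?thesis by (rule C21_onI)
qed

text \<open>The bound on \<open>D\<close> gives |h| \<le> 2 |h + D h|. This yields injectivity,
  hence bijectivity in finite dimension, and it also bounds the inverse by 2.\<close>

lemma blinfun_inverse_perturb_id:
  fixes D :: "'a::euclidean_space \<Rightarrow>\<^sub>L 'a"
  assumes "norm D \<le> 1/2"
  obtains Q where "Q o\<^sub>L (id_blinfun + D) = id_blinfun" "(id_blinfun + D) o\<^sub>L Q = id_blinfun" "norm Q \<le> 2"
proof -
  define A where "A = id_blinfun + D"
  have lin: "linear (blinfun_apply A)" using blinfun.bounded_linear_right bounded_linear.linear by blast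
  have low: "norm h \<le> 2 * norm (A h)" for h
  proof -
    have "norm (D h) \<le> 1/2 * norm h"
      using norm_blinfun[of D h] assms mult_right_mono[of "norm D" "1/2" "norm h"] by simp
    moreover have "A h = h + D h" by (simp add: A_def plus_blinfun.rep_eq)
    ultimately show ?thesis using norm_diff_ineq[of h "D h"] by simp
  qed
  have "inj (blinfun_apply A)"
    using low unfolding linear_injective_0[OF lin] by (metis mult_zero_right norm_le_zero_iff norm_zero)
  then obtain g where g: "linear g" "\<And>x. g (A x) = x" "\<And>x. A (g x) = x"
    using linear_injective_isomorphism[OF lin] by blast
  have bg: "bounded_linear g" using g(1) linear_conv_bounded_linear by blast
  show ?thesis
  proof (rule that[of "Blinfun g", folded A_def])
    show "Blinfun g o\<^sub>L A = id_blinfun" "A o\<^sub>L Blinfun g = id_blinfun"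
      by (auto intro!: blinfun_eqI simp: bounded_linear_Blinfun_apply[OF bg] g)
    show "norm (Blinfun g) \<le> 2"
      by (rule norm_blinfun_bound) (use low[of "g _"] in \<open>auto simp: bounded_linear_Blinfun_apply[OF bg] g(3)\<close>)
  qed
qed

text \<open>Extended by zero, \<open>u\<close> stays a contraction on the whole space, so adding it
  to the identity gives a bijection of the space. This bijection is the identity outside
  \<open>S\<close> and therefore maps \<open>S\<close> onto itself.\<close>

lemma bij_betw_perturb_id:
  fixes u :: "'a::euclidean_space \<Rightarrow> 'a"
  assumes "closed S" and u: "(1/2)-lipschitz_on S u" and bd: "\<And>x. x \<in> frontier S \<Longrightarrow> u x = 0"
  shows "bij_betw (\<lambda>x. x + u x) S S"
proof -
  define w where "w x = (if x \<in> S then u x else 0)" for x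
  have wa: "norm (w x - w y) \<le> 1/2 * norm (x - y)" if x: "x \<in> S" and y: "y \<notin> S" for x y
  proof -
    \<comment> \<open>The segment leaves \<open>S\<close> through a frontier point, where
      \<open>u\<close> vanishes; only its part up to that point counts.\<close>
    have "closed_segment x y \<inter> frontier S \<noteq> {}"
      by (rule connected_Int_frontier) (use x y in auto)
    then obtain z where z: "z \<in> closed_segment x y" "z \<in> frontier S" by blast
    have zS: "z \<in> S" using z(2) \<open>closed S\<close> frontier_subset_closed by blast
    have "norm (u x - u z) \<le> 1/2 * norm (x - z)"
      using lipschitz_onD[OF u x zS] by (simp add: dist_norm)
    also have "\<dots> \<le> 1/2 * norm (x - y)"
      using segment_bound[OF z(1)] by (simp add: norm_minus_commute)
    finally show ?thesis using x y bd[OF z(2)] by (simp add: w_def)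
  qed
  have w: "norm (w x - w y) \<le> 1/2 * norm (x - y)" for x y
  proof -
    consider "x \<in> S" "y \<in> S" | "x \<in> S" "y \<notin> S" | "x \<notin> S" "y \<in> S" | "x \<notin> S" "y \<notin> S" by blast
    then show ?thesis
    proof cases
      case 1
      then show ?thesis using lipschitz_onD[OF u 1] by (simp add: dist_norm w_def)
    next
      case 3
      then show ?thesis using wa[of y x] by (simp add: norm_minus_commute)
    qed (use wa in \<open>auto simp: w_def\<close>)
  qed
  have inj: "x = y" if "x + w x = y + w y" for x y
  proof -
    have "x - y = w y - w x" using that by (simp add: algebra_simps)
    then have "norm (x - y) \<le> 1/2 * norm (x - y)" using w[of y x] by (simp add: norm_minus_commute)
    then show ?thesis by simp
  qed
  have surj: "\<exists>x. x + w x = y" for y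
  proof -
    \<comment> \<open>Banach's theorem for the contraction sending x to
      \<open>y - w x\<close>.\<close>
    have "\<exists>!x. y - w x = x"
      by (rule banach_fix_type[of "1/2"]) (use w in \<open>auto simp: dist_norm norm_minus_commute\<close>)
    then obtain x where "y - w x = x" by blast
    then have "x + w x = y" by (simp add: algebra_simps)
    then show ?thesis ..
  qed
  show ?thesis
  proof (rule bij_betw_imageI)
    show "inj_on (\<lambda>x. x + u x) S"
      by (rule inj_onI, rule inj) (simp add: w_def)
    show "(\<lambda>x. x + u x) ` S = S"
    proof (intro equalityI subsetI)
      fix y assume "y \<in> (\<lambda>x. x + u x) ` S"
      then obtain x where x: "x \<in> S" "y = x + w x" by (auto simp: w_def)
      show "y \<in> S"
      proof (rule ccontr)
        assume "y \<notin> S"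
        \<comment> \<open>Outside \<open>S\<close> the extended map is the identity, so
          \<open>y\<close> would be a second preimage of itself.\<close>
        then have "y + w y = x + w x" using x by (simp add: w_def)
        from inj[OF this] show False using x \<open>y \<notin> S\<close> by simp
      qed
    next
      fix y assume y: "y \<in> S"
      obtain x where x: "x + w x = y" using surj by blast
      then have "x \<in> S" using y by (auto simp: w_def split: if_splits)
      then show "y \<in> (\<lambda>x. x + u x) ` S" using x by (auto simp: w_def)
    qed
  qed
qed

lemma C21_diffeomorphism_perturb_id:
  fixes u :: "'a::euclidean_space \<Rightarrow> 'a"
  assumes "compact S" "convex S"
    and u: "\<And>x. x \<in> S \<Longrightarrow> (u has_derivative blinfun_apply (D x)) (at x within S)" "C11_on S D"
    and D: "\<And>x. x \<in> S \<Longrightarrow> norm (D x) \<le> 1/2"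
    and bd: "\<And>x. x \<in> frontier S \<Longrightarrow> u x = 0"
  shows "C21_diffeomorphism S S (\<lambda>x. x + u x)"
proof -
  have bS: "bounded S" and cS: "closed S" using assms(1) by (auto simp: compact_imp_bounded compact_imp_closed)
  have lip: "(1/2)-lipschitz_on S u"
  proof (rule lipschitz_onI)
    fix x y assume "x \<in> S" "y \<in> S"
    then show "dist (u x) (u y) \<le> 1/2 * dist x y" unfolding dist_norm
      by (intro differentiable_bound[OF assms(2) u(1)]) (use D in \<open>auto simp: norm_blinfun.rep_eq\<close>)
  qed simp
  define f where "f = (\<lambda>x. x + u x)"
  have bij: "bij_betw f S S" unfolding f_def by (rule bij_betw_perturb_id[OF cS lip bd])
  define v where "v = inv_into S f"
  have vS: "v ` S \<subseteq> S" and fv: "\<And>y. y \<in> S \<Longrightarrow> f (v y) = y" and vf: "\<And>x. x \<in> S \<Longrightarrow> v (f x) = x"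
    using bij unfolding v_def bij_betw_def
    by (auto simp: f_inv_into_f inv_into_f_f intro: inv_into_into)
  \<comment> \<open>The contraction term is absorbed: |v y - v z| \<le> |y - z| + |v y - v z| /
    2.\<close>
  have "2-lipschitz_on S v"
  proof (rule lipschitz_onI)
    fix y z assume yz: "y \<in> S" "z \<in> S"
    then have v: "v y \<in> S" "v z \<in> S" using vS by auto
    have "v y - v z = (y - z) - (u (v y) - u (v z))"
      using fv[OF yz(1)] fv[OF yz(2)] unfolding f_def by (simp add: algebra_simps)
    then have "norm (v y - v z) \<le> norm (y - z) + norm (u (v y) - u (v z))"
      by (metis norm_triangle_ineq4)
    then show "dist (v y) (v z) \<le> 2 * dist y z"
      using lipschitz_onD[OF lip v] by (simp add: dist_norm)
  qed simp
  moreover define A where "A x = id_blinfun + D x" for x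
  have f: "(f has_derivative blinfun_apply (A x)) (at x within S)" if "x \<in> S" for x
    unfolding f_def using has_derivative_add[OF has_derivative_ident u(1)[OF that]]
    by (simp add: A_def plus_blinfun.rep_eq)
  moreover have A: "C11_on S A" unfolding A_def by (intro C11_on_add C11_on_const u)
  moreover obtain Q where Q: "\<And>x. x \<in> S \<Longrightarrow> Q x o\<^sub>L A x = id_blinfun"
    "\<And>x. x \<in> S \<Longrightarrow> A x o\<^sub>L Q x = id_blinfun" "\<And>x. x \<in> S \<Longrightarrow> norm (Q x) \<le> 2"
  proof -
    have "\<forall>x\<in>S. \<exists>Q. Q o\<^sub>L A x = id_blinfun \<and> A x o\<^sub>L Q = id_blinfun \<and> norm Q \<le> 2"
      unfolding A_def using blinfun_inverse_perturb_id[OF D] by metis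
    then obtain Q where "\<forall>x\<in>S. Q x o\<^sub>L A x = id_blinfun \<and> A x o\<^sub>L Q x = id_blinfun \<and> norm (Q x) \<le> 2"
      by (rule bchoice[THEN exE])
    then show ?thesis using that by blast
  qed
  ultimately have "C21_on S v"
    using C21_on_inverse[OF assms(2) bS assms(2) bS f A Q _ vS _ vf fv]
      bij_betw_imp_surj_on[OF bij] by simp
  moreover have "C21_on S f" using f A by (rule C21_onI)
  ultimately show ?thesis using bij unfolding C21_diffeomorphism_def v_def f_def by blast
qed

lemma C21_diffeomorphism_compose:
  assumes "convex S" "bounded S" "convex T" "bounded T" "convex U" "bounded U"
    and f: "C21_diffeomorphism S T f" and g: "C21_diffeomorphism T U g"
  shows "C21_diffeomorphism S U (\<lambda>x. g (f x))"
proof -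
  have bf: "bij_betw f S T" and bg: "bij_betw g T U"
    using f g by (auto simp: C21_diffeomorphism_def)
  have fS: "f ` S = T" and gT: "g ` T = U" using bf bg by (auto simp: bij_betw_def)
  have b: "bij_betw (\<lambda>x. g (f x)) S U" using bij_betw_trans[OF bf bg] by (simp add: o_def)
  have gU: "inv_into T g ` U = T" using bij_betw_inv_into[OF bg] by (simp add: bij_betw_def)
  have 1: "C21_on S (\<lambda>x. g (f x))"
    by (rule C21_on_compose[OF assms(1-4)]) (use f g fS in \<open>auto simp: C21_diffeomorphism_def\<close>)
  have 2: "C21_on U (\<lambda>x. inv_into S f (inv_into T g x))"
    by (rule C21_on_compose[OF assms(5,6,3,4)]) (use f g gU in \<open>auto simp: C21_diffeomorphism_def\<close>)
  have "inv_into S f (inv_into T g x) = inv_into S (\<lambda>x. g (f x)) x" if "x \<in> U" for x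
    using inv_into_comp[of g f S x] that bf bg b
    by (auto simp: bij_betw_def o_def)
  then show ?thesis
    using b 1 C21_on_cong[OF 2] unfolding C21_diffeomorphism_def by blast
qed

subsection \<open>Functions of one variable and polar coordinates\<close>

text \<open>This covers one-sided derivatives at boundary points. Along the segment from
  \<open>x\<close> to a point q of \<open>S\<close> both candidates give the same one-variable
  derivative, so they agree on q - x. When q runs through an interior ball, differences of such
  vectors point in all directions.\<close>

lemma has_derivative_unique_within_convex:
  fixes f :: "'a::real_normed_vector \<Rightarrow> 'b::real_normed_vector"
  assumes "convex S" "interior S \<noteq> {}" "x \<in> S"
    and A: "(f has_derivative A) (at x within S)" and B: "(f has_derivative B) (at x within S)"
  shows "A = B"
proof
  fix h :: 'a
  interpret A: bounded_linear A using A by (rule has_derivative_bounded_linear)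
  interpret B: bounded_linear B using B by (rule has_derivative_bounded_linear)
  have dir: "A (q - x) = B (q - x)" if q: "q \<in> S" for q
  proof -
    define l where "l s = x + s *\<^sub>R (q - x)" for s :: real
    have lS: "l ` {0..1} \<subseteq> S"
    proof
      fix y assume "y \<in> l ` {0..1}"
      then obtain s where "s \<in> {0..1}" "y = (1 - s) *\<^sub>R x + s *\<^sub>R q"
        by (auto simp: l_def algebra_simps)
      then show "y \<in> S" using assms(1,3) q by (simp add: convex_alt)
    qed
    have l: "(l has_derivative (\<lambda>s. s *\<^sub>R (q - x))) (at 0 within {0..1})"
      unfolding l_def by (auto intro!: derivative_eq_intros)
    have l0: "l 0 = x" by (simp add: l_def)
    have "((\<lambda>s. f (l s)) has_vector_derivative C (q - x)) (at 0 within {0..1})"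
      if "(f has_derivative C) (at x within S)" for C
    proof -
      interpret C: bounded_linear C using that by (rule has_derivative_bounded_linear)
      have "(f has_derivative C) (at (l 0) within l ` {0..1})"
        using has_derivative_subset[OF that lS] l0 by simp
      from has_derivative_in_compose[OF l this] show ?thesis
        by (simp add: has_vector_derivative_def C.scaleR)
    qed
    from this[OF A] this[OF B] show ?thesis
      using vector_derivative_unique_within_closed_interval[of 0 1 0 "\<lambda>s. f (l s)" "A (q - x)" "B (q - x)"]
      by simp
  qed
  obtain c e where ce: "e > 0" "cball c e \<subseteq> S"
    using assms(2) by (metis all_not_in_conv mem_interior_cball)
  \<comment> \<open>Scales \<open>h\<close> so that \<open>c + k *\<^sub>R h\<close> stays in the
    ball; the added 1 allows \<open>h\<close> to be 0.\<close>
  define k where "k = e / (norm h + 1)"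
  have k: "k > 0" using ce by (simp add: k_def add_nonneg_pos)
  have "norm (k *\<^sub>R h) \<le> e"
    using ce(1) by (simp add: k_def divide_simps add_nonneg_pos mult_left_mono)
  then have "c + k *\<^sub>R h \<in> S" "c \<in> S" using ce by (auto simp: dist_norm subset_iff)
  then have "A (c + k *\<^sub>R h - x) - A (c - x) = B (c + k *\<^sub>R h - x) - B (c - x)"
    using dir by metis
  then have "k *\<^sub>R A h = k *\<^sub>R B h"
    by (simp add: A.diff B.diff A.add B.add A.scaleR B.scaleR)
  then show "A h = B h" using k by simp
qed

section \<open>Regularity of elementary functions of one variable\<close>

lemma C11_on_realI:
  assumes "\<And>t. t \<in> I \<Longrightarrow> (f has_real_derivative f1 t) (at t within I)" "L-lipschitz_on I f1"
  shows "C11_on I f"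
proof -
  obtain K where "K-lipschitz_on I (\<lambda>t. blinfun_mult_right (f1 t))"
    using lipschitz_on_linear[OF bounded_linear_blinfun_mult_right assms(2)] by blast
  then show ?thesis
    by (rule C11_onI[rotated])
      (use assms(1) in \<open>simp add: has_field_derivative_def blinfun_mult_right.rep_eq\<close>)
qed

lemma C21_on_realI:
  assumes "\<And>t. t \<in> I \<Longrightarrow> (f has_real_derivative f1 t) (at t within I)" "C11_on I f1"
  shows "C21_on I f"
proof -
  have "C11_on I (\<lambda>t. blinfun_mult_right (f1 t))"
    using C11_on_linear_compose[OF bounded_linear_blinfun_mult_right assms(2)] .
  then show ?thesis
    by (rule C21_onI[rotated])
      (use assms(1) in \<open>simp add: has_field_derivative_def blinfun_mult_right.rep_eq\<close>)
qed

text \<open>The second derivative is bounded on the compact interval, and its bound is a Lipschitz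
  constant of the first.\<close>

lemma C11_on_realI2:
  assumes f: "\<And>t. t \<in> {l..u} \<Longrightarrow> (f has_real_derivative f1 t) (at t)"
    and f1: "\<And>t. t \<in> {l..u} \<Longrightarrow> (f1 has_real_derivative f2 t) (at t)"
    and f2: "continuous_on {l..u} f2"
  shows "C11_on {l..u} f"
proof -
  have "bounded (f2 ` {l..u})"
    using compact_imp_bounded[OF compact_continuous_image[OF f2]] by simp
  then obtain B where B: "B > 0" "\<And>t. t \<in> {l..u} \<Longrightarrow> \<bar>f2 t\<bar> \<le> B"
    by (auto simp: bounded_pos)
  have "B-lipschitz_on {l..u} f1"
  proof (rule lipschitz_onI)
    fix x y assume "x \<in> {l..u}" "y \<in> {l..u}"
    then show "dist (f1 x) (f1 y) \<le> B * dist x y"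
      unfolding dist_norm
      by (intro field_differentiable_bound[of "{l..u}" f1 f2])
        (use f1 B in \<open>auto intro: DERIV_subset\<close>)
  qed (use B in simp)
  then show ?thesis
    by (rule C11_on_realI[rotated]) (use f in \<open>auto intro: DERIV_subset\<close>)
qed

lemma C11_on_exp: "C11_on {l..u} (exp :: real \<Rightarrow> real)"
  by (rule C11_on_realI2[of _ _ _ exp exp]) (auto intro!: continuous_intros derivative_eq_intros)

lemma C11_on_ln: "0 < l \<Longrightarrow> C11_on {l..u} (ln :: real \<Rightarrow> real)"
  by (rule C11_on_realI2[of _ _ _ "\<lambda>t. inverse t" "\<lambda>t. - (inverse t * inverse t)"])
    (auto intro!: continuous_intros derivative_eq_intros simp: field_simps)

lemma C11_on_real_inverse: "0 < l \<Longrightarrow> C11_on {l..u} (inverse :: real \<Rightarrow> real)"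
  by (rule C11_on_realI2[of _ _ _ "\<lambda>t. - (inverse t * inverse t)" "\<lambda>t. 2 * inverse t ^ 3"])
    (auto intro!: continuous_intros derivative_eq_intros simp: field_simps power3_eq_cube power2_eq_square)

lemma C21_on_real_inverse:
  assumes "0 < l" shows "C21_on {l..u} (inverse :: real \<Rightarrow> real)"
proof (rule C21_on_realI[of _ _ "\<lambda>t. - (inverse t * inverse t)"])
  show "C11_on {l..u} (\<lambda>t::real. - (inverse t * inverse t))"
    using assms
    by (intro C11_on_realI2[of _ _ _ "\<lambda>t. 2 * inverse t ^ 3" "\<lambda>t. - 6 * inverse t ^ 4"])
      (auto intro!: continuous_intros derivative_eq_intros simp: field_simps power3_eq_cube power4_eq_xxxx power2_eq_square)
qed (use assms in \<open>auto intro!: derivative_eq_intros simp: field_simps\<close>)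

lemma C21_on_arctan: "C21_on {l..u} arctan"
proof (rule C21_on_realI[of _ _ "\<lambda>t. inverse (1 + t * t)"])
  define K where "K = (\<bar>l\<bar> + \<bar>u\<bar>) * (\<bar>l\<bar> + \<bar>u\<bar>)"
  have K: "t * t \<le> K" if "t \<in> {l..u}" for t
  proof -
    have "\<bar>t\<bar> * \<bar>t\<bar> \<le> K" unfolding K_def by (rule mult_mono) (use that in auto)
    then show ?thesis by simp
  qed
  have *: "C11_on {l..u} (\<lambda>t. 1 + t * t)"
    by (intro C11_on_add C11_on_const C11_on_bilinear[OF bounded_bilinear_mult] C11_on_linear)
      (auto intro: bounded_linear_ident)
  show "C11_on {l..u} (\<lambda>t. inverse (1 + t * t))"
    by (rule C11_on_compose[OF _ _ _ _ C11_on_real_inverse[of 1 "1 + K"] *])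
      (use K in auto)
  show "(arctan has_real_derivative inverse (1 + t * t)) (at t within {l..u})" for t
    using DERIV_subset[OF DERIV_arctan[of t]] by (simp add: power2_eq_square)
qed

lemma DERIV_max_0_power:
  fixes t :: real
  shows "((\<lambda>t::real. max 0 t ^ Suc (Suc n)) has_real_derivative (Suc (Suc n) * max 0 t ^ Suc n)) (at t)"
proof -
  consider "t > 0" | "t < 0" | "t = 0" by linarith
  then show ?thesis
  proof cases
    case 1
    have "((\<lambda>t::real. t ^ Suc (Suc n)) has_real_derivative (Suc (Suc n) * t ^ Suc n)) (at t)"
      using DERIV_pow[of "Suc (Suc n)" t] by simp
    then show ?thesis
      using has_field_derivative_transform_within_open[of "\<lambda>t. t ^ Suc (Suc n)" _ t "{0<..}"
          "\<lambda>t. max 0 t ^ Suc (Suc n)"] 1 by simp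
  next
    case 2
    have "((\<lambda>t::real. 0) has_real_derivative 0) (at t)" by simp
    then have "((\<lambda>t::real. max 0 t ^ Suc (Suc n)) has_real_derivative 0) (at t)"
      by (rule has_field_derivative_transform_within_open[of _ _ _ "{..<0}"]) (use 2 in auto)
    then show ?thesis using 2 by simp
  next
    case 3
    \<comment> \<open>At 0 the difference quotient is the truncated power of one degree less, on
      both sides.\<close>
    have "((\<lambda>h::real. max 0 h ^ Suc n) \<longlongrightarrow> max 0 0 ^ Suc n) (at 0)"
      by (intro tendsto_intros)
    then have "((\<lambda>h::real. max 0 h ^ Suc n) \<longlongrightarrow> 0) (at 0)" by simp
    then have "((\<lambda>h::real. max 0 h ^ Suc (Suc n) / h) \<longlongrightarrow> 0) (at 0)"
      by (rule Lim_transform_eventually)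
        (auto simp: eventually_at max_def intro!: exI[of _ 1])
    then show ?thesis unfolding DERIV_def 3 by simp
  qed
qed

text \<open>The cube is the lowest power that works: its second derivative
  \<open>6 * max 0 t\<close> is Lipschitz but not differentiable. The cutoff function below takes
  its exponent from here.\<close>

lemma C21_on_max_0_cube: "C21_on {l..u} (\<lambda>t::real. max 0 t ^ 3)"
proof (rule C21_on_realI[of _ _ "\<lambda>t. 3 * max 0 t ^ 2"])
  show "((\<lambda>t. max 0 t ^ 3) has_real_derivative 3 * max 0 t ^ 2) (at t within {l..u})" for t :: real
    using DERIV_subset[OF DERIV_max_0_power[of 1 t]] by (simp add: numeral_3_eq_3 numeral_2_eq_2)
  have "1-lipschitz_on {l..u} (\<lambda>t::real. max 0 t)"
    by (rule lipschitz_onI) (auto simp: dist_real_def)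
  then have "\<exists>L. L-lipschitz_on {l..u} (\<lambda>t::real. 6 * max 0 t)"
    by (rule lipschitz_on_linear[OF bounded_linear_mult_right])
  then show "C11_on {l..u} (\<lambda>t. 3 * max 0 t ^ 2)"
  proof (elim exE, intro C11_on_realI)
    show "((\<lambda>t. 3 * max 0 t ^ 2) has_real_derivative 6 * max 0 t) (at t within {l..u})" for t :: real
      using DERIV_cmult[OF DERIV_subset[OF DERIV_max_0_power[of 0 t]], of _ 3]
      by (simp add: numeral_2_eq_2)
  qed
qed

section \<open>Polar coordinates in the plane\<close>

definition circ :: "real \<Rightarrow> real^2"
  where "circ \<theta> = vector [cos \<theta>, sin \<theta>]"

definition rot90 :: "real^2 \<Rightarrow> real^2"
  where "rot90 x = vector [- x$2, x$1]"

lemma circ_nth [simp]: "circ \<theta> $ 1 = cos \<theta>" "circ \<theta> $ 2 = sin \<theta>"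
  by (simp_all add: circ_def)

lemma rot90_nth [simp]: "rot90 x $ 1 = - x$2" "rot90 x $ 2 = x$1"
  by (simp_all add: rot90_def)

lemma inner_2: "x \<bullet> y = x$1 * y$1 + x$2 * y$2" for x y :: "real^2"
  by (simp add: inner_vec_def sum_2)

lemma vec2_eq_iff: "x = y \<longleftrightarrow> x$1 = y$1 \<and> x$2 = y$2" for x y :: "real^2"
  by (simp add: vec_eq_iff forall_2)

lemma bounded_linear_rot90: "bounded_linear rot90"
  unfolding linear_conv_bounded_linear[symmetric]
  by (rule linearI) (simp_all add: vec2_eq_iff algebra_simps)

lemma norm_rot90 [simp]: "norm (rot90 x) = norm x"
  by (simp add: norm_eq_sqrt_inner inner_2 algebra_simps)

lemma inner_rot90_self [simp]: "x \<bullet> rot90 x = 0" "rot90 x \<bullet> x = 0"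
  by (simp_all add: inner_2 algebra_simps)

lemma norm_circ [simp]: "norm (circ \<theta>) = 1"
  using sin_cos_squared_add2[of \<theta>] by (simp add: norm_eq_sqrt_inner inner_2)

lemma circ_inner_circ [simp]: "circ \<theta> \<bullet> circ \<theta> = 1"
  using norm_circ[of \<theta>] by (simp add: norm_eq_sqrt_inner)

lemma circ_mem [simp]: "circ \<theta> \<in> unit_disk" "circ \<theta> \<in> unit_circle"
  by (simp_all)

lemma circ_add: "circ (\<theta> + \<phi>) = cos \<phi> *\<^sub>R circ \<theta> + sin \<phi> *\<^sub>R rot90 (circ \<theta>)"
  by (simp add: vec2_eq_iff cos_add sin_add algebra_simps)

lemma circ_decomp: "v = (circ \<theta> \<bullet> v) *\<^sub>R circ \<theta> + (rot90 (circ \<theta>) \<bullet> v) *\<^sub>R rot90 (circ \<theta>)"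
proof -
  have "c\<^sup>2 + s\<^sup>2 = 1 \<Longrightarrow> a = (c * a + s * b) * c - (c * b - s * a) * s"
    "c\<^sup>2 + s\<^sup>2 = 1 \<Longrightarrow> b = (c * a + s * b) * s + (c * b - s * a) * c" for a b c s :: real
    by algebra+
  then show ?thesis using sin_cos_squared_add2[of \<theta>]
    by (auto simp: vec2_eq_iff inner_2 power2_eq_square algebra_simps)
qed

lemma polar: "\<exists>\<theta>. x = norm x *\<^sub>R circ \<theta>"
proof (cases "x = 0")
  case False
  then have n: "norm x > 0" by simp
  have "x \<bullet> x = norm x ^ 2" by (simp add: power2_norm_eq_inner)
  then have "(x$1 / norm x)\<^sup>2 + (x$2 / norm x)\<^sup>2 = 1"
    using n unfolding inner_2 by (simp add: power_divide flip: add_divide_distrib power2_eq_square)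
  then obtain t where t: "x$1 / norm x = cos t" "x$2 / norm x = sin t"
    using sincos_total_2pi by metis
  have "norm x * cos t = x$1" "norm x * sin t = x$2" using n unfolding t[symmetric] by simp_all
  then have "x = norm x *\<^sub>R circ t" unfolding vec2_eq_iff by simp
  then show ?thesis ..
qed simp

lemma circ_eq_imp:
  assumes "circ \<theta> = circ \<phi>"
  obtains n :: int where "\<theta> = \<phi> + of_int n * (2 * pi)"
proof -
  have "sin \<theta> = sin \<phi> \<and> cos \<theta> = cos \<phi>" using assms by (simp add: vec2_eq_iff)
  then obtain n where "\<theta> = \<phi> + 2 * pi * of_int n" unfolding sin_cos_eq_iff by blast
  then show ?thesis using that[of n] by (simp add: mult_ac)
qed

lemma circ_surj: "p \<in> unit_circle \<Longrightarrow> \<exists>\<theta>. p = circ \<theta>"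
  using polar[of p] by simp

lemma circ_periodic [simp]: "circ (\<theta> + 2 * pi) = circ \<theta>"
  by (simp add: vec2_eq_iff)

lemma circ_has_derivative: "(circ has_derivative (\<lambda>s. s *\<^sub>R rot90 (circ \<theta>))) (at \<theta> within I)"
proof -
  define e1 e2 :: "real^2" where "e1 = vector [1, 0]" and "e2 = vector [0, 1]"
  have *: "circ = (\<lambda>\<theta>. cos \<theta> *\<^sub>R e1 + sin \<theta> *\<^sub>R e2)"
    by (simp add: fun_eq_iff vec2_eq_iff e1_def e2_def)
  have "((\<lambda>\<theta>. cos \<theta> *\<^sub>R e1 + sin \<theta> *\<^sub>R e2) has_derivative
      (\<lambda>s. (s * - sin \<theta>) *\<^sub>R e1 + (s * cos \<theta>) *\<^sub>R e2)) (at \<theta> within I)"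
    by (auto intro!: derivative_eq_intros)
  moreover have "(\<lambda>s. (s * - sin \<theta>) *\<^sub>R e1 + (s * cos \<theta>) *\<^sub>R e2)
      = (\<lambda>s. s *\<^sub>R rot90 (circ \<theta>))"
    by (simp add: fun_eq_iff vec2_eq_iff e1_def e2_def)
  ultimately show ?thesis by (simp add: *)
qed

text \<open>An arbitrary branch without any continuity. It is harmless because it only enters
  \<open>wave\<close>, whose value at a nonzero point does not change when a multiple of 2 pi is
  added.\<close>

definition angle :: "real^2 \<Rightarrow> real"
  where "angle x = (SOME \<theta>. x = norm x *\<^sub>R circ \<theta>)"

lemma angle: "x = norm x *\<^sub>R circ (angle x)"
  unfolding angle_def by (rule someI_ex[OF polar])

lemma angle_eqE:
  assumes "x = norm x *\<^sub>R circ \<theta>" "x \<noteq> 0"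
  obtains n :: int where "angle x = \<theta> + of_int n * (2 * pi)"
proof -
  have "norm x *\<^sub>R circ (angle x) = norm x *\<^sub>R circ \<theta>"
    using trans[OF angle[symmetric] assms(1)] .
  then have "circ (angle x) = circ \<theta>" using assms(2) by simp
  then show ?thesis using circ_eq_imp that by blast
qed

subsection \<open>Extension by d'Alembert's formula\<close>

lemma C21_on_real_compose:
  fixes g :: "'a::real_normed_vector \<Rightarrow> real"
  assumes "convex S" "bounded S" "C21_on S g" and f: "\<And>l u. C21_on {l..u} f"
  shows "C21_on S (\<lambda>x. f (g x))"
proof -
  obtain L where "L-lipschitz_on S g"
    using C11_on_lipschitz[OF assms(1,2) C21_on_imp_C11_on[OF assms(1-3)]] .
  then obtain K where "\<And>x. x \<in> S \<Longrightarrow> norm (g x) \<le> K"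
    using lipschitz_on_bounded_norm[OF assms(2)] by blast
  then have "g ` S \<subseteq> {-K..K}" by (force simp: abs_le_iff)
  from C21_on_compose[OF assms(1,2) _ _ f assms(3) this] show ?thesis by simp
qed

text \<open>Functions on the circle are encoded on the line, because their antiderivatives are in
  general not periodic and live only there.\<close>

definition periodic_C11 :: "(real \<Rightarrow> real) \<Rightarrow> bool"
  where "periodic_C11 a \<longleftrightarrow> (\<forall>\<theta>. a (\<theta> + 2 * pi) = a \<theta>) \<and> (\<forall>l u. C11_on {l..u} a)"

lemma periodic_C11_of_int:
  assumes "periodic_C11 a"
  shows "a (\<theta> + of_int n * (2 * pi)) = a \<theta>"
proof -
  interpret periodic_fun_simple a "2 * pi"
    by unfold_locales (use assms in \<open>simp add: periodic_C11_def\<close>)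
  show ?thesis by (rule plus_of_int)
qed

lemma periodic_C11_isCont:
  assumes "periodic_C11 a"
  shows "isCont a \<theta>"
proof -
  have "C11_on {\<theta>-1..\<theta>+1} a" using assms by (simp add: periodic_C11_def)
  then obtain f' where "(a has_derivative blinfun_apply f') (at \<theta> within {\<theta>-1..\<theta>+1})"
    unfolding C11_on_def by force
  then have "continuous (at \<theta> within {\<theta>-1..\<theta>+1}) a" by (rule has_derivative_continuous)
  then show ?thesis by (simp add: at_within_Icc_at)
qed

lemma periodic_C11_antiderivative:
  assumes "periodic_C11 a"
  obtains h where "\<And>t. (h has_real_derivative a t) (at t)"
proof -
  have "\<exists>h. \<forall>x::real. (-\<infinity>::ereal) < x \<longrightarrow> x < \<infinity> \<longrightarrow> (h has_vector_derivative a x) (at x)"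
    by (rule einterval_antiderivative) (use periodic_C11_isCont[OF assms] in auto)
  then show ?thesis using that by (auto simp: has_real_derivative_iff_has_vector_derivative)
qed

text \<open>A smooth branch of the angle near \<open>x0\<close>: the arctangent of the slope of
  \<open>x\<close> in the orthogonal frame (\<open>x0\<close>, \<open>rot90 x0\<close>), valid where
  \<open>x0 \<bullet> x\<close> is positive.\<close>

definition local_angle :: "real^2 \<Rightarrow> real \<Rightarrow> real^2 \<Rightarrow> real"
  where "local_angle x0 \<theta>0 x = \<theta>0 + arctan ((rot90 x0 \<bullet> x) * inverse (x0 \<bullet> x))"

context
  fixes x0 :: "real^2" and \<theta>0 :: real
  assumes x0: "x0 = norm x0 *\<^sub>R circ \<theta>0" "x0 \<noteq> 0"
begin

text \<open>Half the norm of \<open>x0\<close> as radius keeps the denominator in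
  \<open>local_angle\<close> away from 0 and the slope within [-2, 2], so that inversion and
  arctangent are applied on compact intervals.\<close>

lemma inner_center_bounds:
  assumes "x \<in> ball x0 (norm x0 / 2)"
  shows "norm x0 ^ 2 / 2 \<le> x0 \<bullet> x" "x0 \<bullet> x \<le> 2 * norm x0 ^ 2" "0 < x0 \<bullet> x"
    "\<bar>rot90 x0 \<bullet> x\<bar> \<le> norm x0 ^ 2"
proof -
  have d: "norm (x - x0) \<le> norm x0 / 2" using assms by (simp add: dist_norm norm_minus_commute)
  have "\<bar>x0 \<bullet> (x - x0)\<bar> \<le> norm x0 * norm (x - x0)" by (rule Cauchy_Schwarz_ineq2)
  also have "\<dots> \<le> norm x0 * (norm x0 / 2)" using d by (intro mult_left_mono) auto
  finally have *: "\<bar>x0 \<bullet> x - norm x0 ^ 2\<bar> \<le> norm x0 ^ 2 / 2"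
    by (simp add: inner_diff_right dot_square_norm power2_eq_square)
  then show 1: "norm x0 ^ 2 / 2 \<le> x0 \<bullet> x" and "x0 \<bullet> x \<le> 2 * norm x0 ^ 2"
    using zero_le_power2[of "norm x0"] by linarith+
  have "norm x0 ^ 2 > 0" using x0(2) by simp
  with 1 show "0 < x0 \<bullet> x" by linarith
  have "\<bar>rot90 x0 \<bullet> (x - x0)\<bar> \<le> norm (rot90 x0) * norm (x - x0)" by (rule Cauchy_Schwarz_ineq2)
  also have "\<dots> \<le> norm x0 * (norm x0 / 2)" using d by (intro mult_mono) auto
  also have "\<dots> \<le> norm x0 ^ 2" by (simp add: power2_eq_square)
  finally show "\<bar>rot90 x0 \<bullet> x\<bar> \<le> norm x0 ^ 2" by (simp add: inner_diff_right)
qed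

lemma local_angle_polar:
  assumes "x \<in> ball x0 (norm x0 / 2)"
  shows "x = norm x *\<^sub>R circ (local_angle x0 \<theta>0 x)"
proof -
  define c s q where "c = circ \<theta>0 \<bullet> x" and "s = rot90 (circ \<theta>0) \<bullet> x" and "q = s / c"
  have r: "norm x0 > 0" using x0(2) by simp
  have e: "x0 \<bullet> x = norm x0 * c" "rot90 x0 \<bullet> x = norm x0 * s"
    using arg_cong[OF x0(1), of "\<lambda>y. y \<bullet> x"] arg_cong[OF x0(1), of "\<lambda>y. rot90 y \<bullet> x"]
    by (simp_all add: c_def s_def linear_cmul[OF bounded_linear.linear[OF bounded_linear_rot90]])
  have c: "c > 0" using inner_center_bounds(3)[OF assms] e r by (simp add: zero_less_mult_iff)
  have la: "local_angle x0 \<theta>0 x = \<theta>0 + arctan q"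
    unfolding local_angle_def e q_def using r c by (simp add: divide_simps)
  have x: "x = c *\<^sub>R circ \<theta>0 + s *\<^sub>R rot90 (circ \<theta>0)"
    unfolding c_def s_def by (rule circ_decomp)
  \<comment> \<open>This square root cancels the denominators in the sine and cosine of
    \<open>arctan q\<close>.\<close>
  have n: "norm x = c * sqrt (1 + q\<^sup>2)"
  proof -
    have "rot90 (circ \<theta>0) \<bullet> rot90 (circ \<theta>0) = 1"
      using norm_rot90[of "circ \<theta>0"] by (simp add: norm_eq_sqrt_inner)
    then have "x \<bullet> x = c\<^sup>2 + s\<^sup>2"
      by (subst (1 2) x) (simp add: inner_add_left inner_add_right power2_eq_square)
    also have "\<dots> = (c * sqrt (1 + q\<^sup>2))\<^sup>2"
      using c by (simp add: power_mult_distrib q_def field_simps)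
    finally show ?thesis using c by (simp add: norm_eq_sqrt_inner real_sqrt_unique)
  qed
  have sq: "sqrt (1 + q\<^sup>2) > 0" by (simp add: add_pos_nonneg)
  show ?thesis
    unfolding la circ_add cos_arctan sin_arctan n
    using c sq by (subst x) (simp add: scaleR_add_right q_def)
qed

lemma C21_on_local_angle: "C21_on (ball x0 (norm x0 / 2)) (local_angle x0 \<theta>0)"
proof -
  define B where "B = ball x0 (norm x0 / 2)"
  define m where "m = norm x0 ^ 2 / 2"
  have m: "m > 0" using x0(2) by (simp add: m_def)
  have [simp]: "convex B" "bounded B" by (simp_all add: B_def)
  have i: "C21_on B (\<lambda>x. inverse (x0 \<bullet> x))"
    by (rule C21_on_compose[OF _ _ _ _ C21_on_real_inverse[OF m, of "2 * norm x0 ^ 2"]])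
      (use inner_center_bounds in \<open>auto simp: B_def m_def intro: C21_on_linear bounded_linear_inner_right\<close>)
  have q: "C21_on B (\<lambda>x. (rot90 x0 \<bullet> x) * inverse (x0 \<bullet> x))"
    by (rule C21_on_bilinear[OF bounded_bilinear_mult _ _ _ i])
      (auto intro: C21_on_linear bounded_linear_inner_right)
  have "C21_on B (\<lambda>x. arctan ((rot90 x0 \<bullet> x) * inverse (x0 \<bullet> x)))"
  proof (rule C21_on_compose[OF _ _ _ _ C21_on_arctan q])
    show "(\<lambda>x. (rot90 x0 \<bullet> x) * inverse (x0 \<bullet> x)) ` B \<subseteq> {-2..2}"
    proof
      fix y assume "y \<in> (\<lambda>x. (rot90 x0 \<bullet> x) * inverse (x0 \<bullet> x)) ` B"
      then obtain x where x: "x \<in> B" and y: "y = (rot90 x0 \<bullet> x) / (x0 \<bullet> x)"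
        by (auto simp: divide_inverse)
      note b = inner_center_bounds[OF x[unfolded B_def]]
      have "\<bar>y\<bar> = \<bar>rot90 x0 \<bullet> x\<bar> / (x0 \<bullet> x)" using b(3) by (simp add: y)
      also have "\<dots> \<le> 2" using b by (simp add: divide_le_eq)
      finally show "y \<in> {-2..2}" by (simp add: abs_le_iff)
    qed
  qed auto
  then show ?thesis
    unfolding local_angle_def[abs_def] B_def[symmetric]
    by (intro C21_on_add C21_on_const)
qed

text \<open>At the centre the slope is 0, where the arctangent has derivative 1. Since every nonzero
  point may serve as centre, no other point has to be treated.\<close>

lemma local_angle_has_derivative:
  "(local_angle x0 \<theta>0 has_derivative (\<lambda>v. (rot90 x0 \<bullet> v) / (x0 \<bullet> x0))) (at x0)"
proof -
  have nz: "x0 \<bullet> x0 \<noteq> 0" using x0(2) by simp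
  have "((\<lambda>x. arctan ((rot90 x0 \<bullet> x) * inverse (x0 \<bullet> x))) has_derivative
    (\<lambda>v. (rot90 x0 \<bullet> v) * inverse (x0 \<bullet> x0))) (at x0)"
  proof -
    have q: "((\<lambda>x. (rot90 x0 \<bullet> x) * inverse (x0 \<bullet> x)) has_derivative
      (\<lambda>v. (rot90 x0 \<bullet> x0) * (- (inverse (x0 \<bullet> x0) * (x0 \<bullet> v) * inverse (x0 \<bullet> x0)))
         + (rot90 x0 \<bullet> v) * inverse (x0 \<bullet> x0))) (at x0)"
      using nz by (auto intro!: derivative_eq_intros)
    have "(arctan has_derivative (*) 1) (at ((rot90 x0 \<bullet> x0) * inverse (x0 \<bullet> x0)))"
      using DERIV_arctan[of 0] by (simp add: has_field_derivative_def)
    from has_derivative_compose[OF q this] show ?thesis by simp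
  qed
  then show ?thesis unfolding local_angle_def[abs_def]
    using has_derivative_add[OF has_derivative_const] by (fastforce simp: divide_inverse)
qed

end

text \<open>
  d'Alembert's formula: \<open>wave h\<close> solves the wave equation in the variables \<open>\<theta>\<close> and
  \<open>t = (1 - \<bar>x\<bar>\<^sup>2) / 2\<close> with zero initial position and initial velocity \<open>h'\<close>. It is as
  regular as \<open>h\<close>, hence gains one derivative over the prescribed normal derivative.
\<close>

definition wave :: "(real \<Rightarrow> real) \<Rightarrow> real^2 \<Rightarrow> real"
  where "wave h x = (h (angle x + (1 - x \<bullet> x) / 2) - h (angle x - (1 - x \<bullet> x) / 2)) / 2"

context
  fixes a h :: "real \<Rightarrow> real"
  assumes a: "periodic_C11 a" and h: "\<And>t. (h has_real_derivative a t) (at t)"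
begin

lemma C21_on_antiderivative: "C21_on {l..u} h"
  by (rule C21_on_realI[of _ _ a]) (use a h in \<open>auto simp: periodic_C11_def intro: DERIV_subset\<close>)

text \<open>The increment of \<open>h\<close> over whole periods has derivative 0, because
  \<open>a\<close> is periodic. It is therefore a constant, which cancels in the difference.\<close>

lemma antiderivative_diff_periodic:
  fixes n :: int
  shows "h (\<theta> + of_int n * (2 * pi) + t) - h (\<theta> + of_int n * (2 * pi) - t) = h (\<theta> + t) - h (\<theta> - t)"
proof -
  define k where "k \<theta> = h (\<theta> + of_int n * (2 * pi)) - h \<theta>" for \<theta>
  have "(k has_real_derivative 0) (at \<theta>)" for \<theta>
  proof -
    have "((\<lambda>\<theta>. h (\<theta> + of_int n * (2 * pi))) has_real_derivative a (\<theta> + of_int n * (2 * pi)) * 1) (at \<theta>)"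
      by (rule DERIV_chain2[OF h]) (auto intro!: derivative_eq_intros)
    then show ?thesis unfolding k_def
      using DERIV_diff[OF _ h] periodic_C11_of_int[OF a] by fastforce
  qed
  then have "k (\<theta> + t) = k (\<theta> - t)" using DERIV_isconst_all[of k] by blast
  then show ?thesis by (simp add: k_def algebra_simps)
qed

text \<open>Any angle of \<open>x\<close> may replace the chosen one; near a given point this is a
  smooth branch.\<close>

lemma wave_local:
  assumes "x = norm x *\<^sub>R circ \<theta>" "x \<noteq> 0"
  shows "wave h x = (h (\<theta> + (1 - x \<bullet> x) / 2) - h (\<theta> - (1 - x \<bullet> x) / 2)) / 2"
  using angle_eqE[OF assms] antiderivative_diff_periodic unfolding wave_def by metis

lemma wave_local_angle:
  assumes "x0 = norm x0 *\<^sub>R circ \<theta>0" "x0 \<noteq> 0" "x \<in> ball x0 (norm x0 / 2)"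
  shows "wave h x = (h (local_angle x0 \<theta>0 x + (1 - x \<bullet> x) / 2) - h (local_angle x0 \<theta>0 x - (1 - x \<bullet> x) / 2)) / 2"
proof (rule wave_local[OF local_angle_polar[OF assms]])
  show "x \<noteq> 0" using inner_center_bounds(3)[OF assms] by auto
qed

lemma C21_on_wave:
  assumes "x0 \<noteq> 0" shows "C21_on (ball x0 (norm x0 / 2)) (wave h)"
proof -
  define B where "B = ball x0 (norm x0 / 2)"
  have [simp]: "convex B" "bounded B" by (simp_all add: B_def)
  obtain \<theta>0 where x0: "x0 = norm x0 *\<^sub>R circ \<theta>0" using polar by blast
  have T: "C21_on B (local_angle x0 \<theta>0)"
    unfolding B_def by (rule C21_on_local_angle[OF x0 assms])
  have t: "C21_on B (\<lambda>x. s *\<^sub>R (1 + (-1) *\<^sub>R (x \<bullet> x)))" for s :: real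
    by (intro C21_on_bilinear[OF bounded_bilinear_scaleR] C21_on_add C21_on_const
        C21_on_bilinear[OF bounded_bilinear_inner] C21_on_linear bounded_linear_ident) auto
  have hs: "C21_on B (\<lambda>x. h (local_angle x0 \<theta>0 x + s *\<^sub>R (1 + (-1) *\<^sub>R (x \<bullet> x))))" for s
    by (rule C21_on_real_compose[OF _ _ C21_on_add[OF T t] C21_on_antiderivative]) auto
  have "C21_on B (\<lambda>x. (1/2) *\<^sub>R (h (local_angle x0 \<theta>0 x + (1/2) *\<^sub>R (1 + (-1) *\<^sub>R (x \<bullet> x)))
      + (-1) *\<^sub>R h (local_angle x0 \<theta>0 x + (-1/2) *\<^sub>R (1 + (-1) *\<^sub>R (x \<bullet> x)))))"
    by (intro C21_on_bilinear[OF bounded_bilinear_scaleR] C21_on_add C21_on_const hs) auto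
  then show ?thesis unfolding B_def[symmetric]
    by (rule C21_on_cong) (simp add: wave_local_angle[OF x0 assms] B_def field_simps)
qed

lemma wave_has_derivative:
  assumes x0: "x0 = norm x0 *\<^sub>R circ \<theta>0" "x0 \<noteq> 0"
  shows "(wave h has_derivative (\<lambda>v.
      (a (\<theta>0 + (1 - x0 \<bullet> x0) / 2) * ((rot90 x0 \<bullet> v) / (x0 \<bullet> x0) - x0 \<bullet> v)
       - a (\<theta>0 - (1 - x0 \<bullet> x0) / 2) * ((rot90 x0 \<bullet> v) / (x0 \<bullet> x0) + x0 \<bullet> v)) / 2)) (at x0)"
proof -
  define T where "T = local_angle x0 \<theta>0"
  have T: "(T has_derivative (\<lambda>v. (rot90 x0 \<bullet> v) / (x0 \<bullet> x0))) (at x0)"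
    unfolding T_def by (rule local_angle_has_derivative[OF x0])
  have T0: "T x0 = \<theta>0" by (simp add: T_def local_angle_def)
  have hd: "(h has_derivative (*) (a y)) (at y)" for y using h by (simp add: has_field_derivative_def)
  have t: "((\<lambda>x. (1 - x \<bullet> x) / 2) has_derivative (\<lambda>v. - (x0 \<bullet> v))) (at x0)"
    by (auto intro!: derivative_eq_intros simp: inner_commute)
  have "((\<lambda>x. (h (T x + (1 - x \<bullet> x) / 2) - h (T x - (1 - x \<bullet> x) / 2)) / 2) has_derivative (\<lambda>v.
      (a (T x0 + (1 - x0 \<bullet> x0) / 2) * ((rot90 x0 \<bullet> v) / (x0 \<bullet> x0) + - (x0 \<bullet> v))
       - a (T x0 - (1 - x0 \<bullet> x0) / 2) * ((rot90 x0 \<bullet> v) / (x0 \<bullet> x0) - - (x0 \<bullet> v))) / 2)) (at x0)"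
    by (intro bounded_linear.has_derivative[OF bounded_linear_divide]
        has_derivative_diff[OF has_derivative_compose[OF has_derivative_add[OF T t] hd]
          has_derivative_compose[OF has_derivative_diff[OF T t] hd]])
  moreover have "x0 \<in> ball x0 (norm x0 / 2)" using x0(2) by simp
  ultimately have "(wave h has_derivative (\<lambda>v.
      (a (T x0 + (1 - x0 \<bullet> x0) / 2) * ((rot90 x0 \<bullet> v) / (x0 \<bullet> x0) + - (x0 \<bullet> v))
       - a (T x0 - (1 - x0 \<bullet> x0) / 2) * ((rot90 x0 \<bullet> v) / (x0 \<bullet> x0) - - (x0 \<bullet> v))) / 2)) (at x0)"
    by (rule has_derivative_transform_within_open[OF _ open_ball])
      (use wave_local_angle[OF x0] in \<open>simp add: T_def\<close>)
  then show ?thesis by (simp add: T0)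
qed

end

text \<open>The two arguments of \<open>h\<close> differ by twice (1 - |x|^2) / 2, and
  \<open>h\<close> has slope at most \<open>m\<close>.\<close>

lemma wave_bound:
  fixes a h :: "real \<Rightarrow> real"
  assumes h: "\<And>t. (h has_real_derivative a t) (at t)" and m: "\<And>t. \<bar>a t\<bar> \<le> m" and x: "norm x \<le> 1"
  shows "\<bar>wave h x\<bar> \<le> m * ((1 - x \<bullet> x) / 2)"
proof -
  have t: "(1 - x \<bullet> x) / 2 \<ge> 0"
    using x power_le_one[of "norm x" 2] by (simp add: power2_norm_eq_inner)
  have "norm (h (angle x + (1 - x \<bullet> x) / 2) - h (angle x - (1 - x \<bullet> x) / 2))
    \<le> m * norm (angle x + (1 - x \<bullet> x) / 2 - (angle x - (1 - x \<bullet> x) / 2))"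
    by (rule field_differentiable_bound[of UNIV h a]) (use h m in auto)
  then show ?thesis using t unfolding wave_def by simp
qed

text \<open>For |x| at least 1/2 the angular term is at most 2 |v| and the radial one at most |v|.
  Each of the two products is thus bounded by 3 m |v|, and so is half their difference.\<close>

lemma wave_derivative_bound:
  fixes a :: "real \<Rightarrow> real"
  assumes m: "\<And>t. \<bar>a t\<bar> \<le> m" and x: "1/2 \<le> norm x" "norm x \<le> 1"
  shows "\<bar>(a s * ((rot90 x \<bullet> v) / (x \<bullet> x) - x \<bullet> v) - a r * ((rot90 x \<bullet> v) / (x \<bullet> x) + x \<bullet> v)) / 2\<bar>
    \<le> 3 * m * norm v"
proof -
  have n0: "norm x > 0" using x by linarith
  have m0: "m \<ge> 0" using m[of 0] by linarith
  have "\<bar>rot90 x \<bullet> v\<bar> \<le> norm x * norm v" using Cauchy_Schwarz_ineq2[of "rot90 x" v] by simp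
  then have "\<bar>(rot90 x \<bullet> v) / (x \<bullet> x)\<bar> \<le> norm v / norm x"
    using n0 unfolding dot_square_norm power2_eq_square abs_divide by (simp add: field_simps)
  also have "\<dots> \<le> 2 * norm v"
    using x n0 mult_right_mono[of "1/2" "norm x" "norm v"] by (simp add: field_simps)
  finally have 1: "\<bar>(rot90 x \<bullet> v) / (x \<bullet> x)\<bar> \<le> 2 * norm v" .
  have "\<bar>x \<bullet> v\<bar> \<le> norm x * norm v" by (rule Cauchy_Schwarz_ineq2)
  also have "\<dots> \<le> norm v" using x(2) mult_right_mono[of "norm x" 1 "norm v"] by simp
  finally have 2: "\<bar>x \<bullet> v\<bar> \<le> norm v" .
  have b: "\<bar>a s * y\<bar> \<le> m * (3 * norm v)" if "\<bar>y\<bar> \<le> 3 * norm v" for s y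
    unfolding abs_mult using that m m0 by (intro mult_mono) auto
  have "\<bar>a s * ((rot90 x \<bullet> v) / (x \<bullet> x) - x \<bullet> v)\<bar> \<le> m * (3 * norm v)"
    "\<bar>a r * ((rot90 x \<bullet> v) / (x \<bullet> x) + x \<bullet> v)\<bar> \<le> m * (3 * norm v)"
    using 1 2 by (intro b; linarith)+
  then show ?thesis by (simp add: abs_le_iff)
qed

subsection \<open>Prescribed normal derivatives\<close>

text \<open>An affine function of |x|^2 that is 0 for |x| = 1/2 and 1 on the circle, truncated and
  cubed to stay C^{2,1}. It removes the singularity of the angle at the centre.\<close>

definition cutoff :: "real^2 \<Rightarrow> real"
  where "cutoff x = max 0 ((4 * (x \<bullet> x) - 1) / 3) ^ 3"

lemma C21_on_cutoff:
  assumes "convex S" "bounded S" shows "C21_on S cutoff"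
proof -
  have "C21_on S (\<lambda>x. (4/3) *\<^sub>R (x \<bullet> x) + (- 1/3))"
    by (intro C21_on_bilinear[OF bounded_bilinear_scaleR] C21_on_add C21_on_const
        C21_on_bilinear[OF bounded_bilinear_inner] C21_on_linear bounded_linear_ident assms)
  from C21_on_real_compose[OF assms this C21_on_max_0_cube]
  have "C21_on S (\<lambda>x. max 0 ((4/3) *\<^sub>R (x \<bullet> x) + (- 1/3)) ^ 3)" .
  moreover have "max 0 ((4/3) *\<^sub>R (x \<bullet> x) + (- 1/3)) ^ 3 = cutoff x" for x :: "real^2"
  proof -
    have "(4/3) *\<^sub>R (x \<bullet> x) + (- 1/3) = (4 * (x \<bullet> x) - 1) / 3" by simp
    then show ?thesis by (simp only: cutoff_def)
  qed
  ultimately show ?thesis by simp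
qed

lemma cutoff_has_derivative:
  "(cutoff has_derivative (\<lambda>v. 8 * max 0 ((4 * (x \<bullet> x) - 1) / 3) ^ 2 * (x \<bullet> v))) (at x)"
proof -
  have 1: "((\<lambda>x. (4 * (x \<bullet> x) - 1) / 3) has_derivative (\<lambda>v. 8 / 3 * (x \<bullet> v))) (at x)"
    by (auto intro!: derivative_eq_intros simp: inner_commute)
  have 2: "((\<lambda>t::real. max 0 t ^ 3) has_derivative (*) (3 * max 0 t ^ 2)) (at t)" for t
    using DERIV_max_0_power[of 1 t]
    by (simp add: numeral_3_eq_3 numeral_2_eq_2 has_field_derivative_def)
  show ?thesis unfolding cutoff_def[abs_def] using has_derivative_compose[OF 1 2] by (simp add: mult_ac)
qed

lemma cutoff_eq_0: "norm x \<le> 1/2 \<Longrightarrow> cutoff x = 0"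
  using power_mono[of "norm x" "1/2" 2] by (simp add: cutoff_def dot_square_norm power_divide)

lemma interior_unit_disk: "interior unit_disk \<noteq> {}"
  by (simp add: interior_cball)

text \<open>The data \<open>a\<close> become the outward normal derivative of a function vanishing
  on the circle, with bounds proportional to the size of \<open>a\<close>. The 6 is 3 + 3: one half
  comes from the derivative of \<open>wave\<close>, the other from that of
  \<open>cutoff\<close>.\<close>

lemma normal_extension:
  assumes a: "periodic_C11 a" and m: "\<And>\<theta>. \<bar>a \<theta>\<bar> \<le> m"
  obtains w where "C21_on unit_disk w" "\<And>x. x \<in> unit_circle \<Longrightarrow> w x = 0"
    "\<And>x. x \<in> unit_disk \<Longrightarrow> \<bar>w x\<bar> \<le> m"
    "\<And>x. x \<in> unit_disk \<Longrightarrow> \<exists>D. (w has_derivative D) (at x) \<and> (\<forall>v. \<bar>D v\<bar> \<le> 6 * m * norm v)"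
    "\<And>\<theta>. (w has_derivative (\<lambda>v. a \<theta> * (circ \<theta> \<bullet> v))) (at (circ \<theta>))"
proof -
  obtain h where h: "\<And>t. (h has_real_derivative a t) (at t)"
    by (metis periodic_C11_antiderivative[OF a])
  \<comment> \<open>The sign is due to (1 - |x|^2) / 2 decreasing outwards.\<close>
  define w where "w x = - (cutoff x * wave h x)" for x
  have m0: "m \<ge> 0" using m[of 0] by linarith
  have c1: "0 \<le> max 0 ((4 * (x \<bullet> x) - 1) / 3)" "max 0 ((4 * (x \<bullet> x) - 1) / 3) \<le> 1"
    if "x \<in> unit_disk" for x :: "real^2"
    using that power_le_one[of "norm x" 2] by (auto simp: dot_square_norm)
  have w_zero: "w x = 0" if "x \<in> ball 0 (1/2)" for x
    using that cutoff_eq_0[of x] by (simp add: w_def)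
  have wd: "(w has_derivative (\<lambda>v. - (cutoff x *
      ((a (\<theta> + (1 - x \<bullet> x) / 2) * ((rot90 x \<bullet> v) / (x \<bullet> x) - x \<bullet> v)
       - a (\<theta> - (1 - x \<bullet> x) / 2) * ((rot90 x \<bullet> v) / (x \<bullet> x) + x \<bullet> v)) / 2) +
      8 * max 0 ((4 * (x \<bullet> x) - 1) / 3) ^ 2 * (x \<bullet> v) * wave h x))) (at x)"
    if "x = norm x *\<^sub>R circ \<theta>" "x \<noteq> 0" for x \<theta>
    unfolding w_def
    by (intro has_derivative_minus has_derivative_mult cutoff_has_derivative wave_has_derivative[OF a h that])
  show ?thesis
  proof (rule that[of w])
    show "C21_on unit_disk w"
    \<comment> \<open>The formula makes sense beyond the disk, so full balls around boundary points
      are available.\<close>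
    proof (rule C21_on_local)
      fix x :: "real^2"
      show "\<exists>e>0. C21_on (ball x e) w"
      proof (cases "x = 0")
        case True
        have "C21_on (ball x (1/2)) w"
          by (rule C21_on_cong[OF C21_on_const[of _ 0]]) (use w_zero True in auto)
        then show ?thesis by (intro exI[of _ "1/2"]) simp
      next
        case False
        have "C21_on (ball x (norm x / 2)) (\<lambda>x. - (cutoff x * wave h x))"
          using C21_on_bilinear[OF bounded_bilinear_mult _ _
              C21_on_bilinear[OF bounded_bilinear_mult _ _ C21_on_cutoff C21_on_wave[OF a h False]]
              C21_on_const[of _ "-1"]] by simp
        then show ?thesis
          using False by (intro exI[of _ "norm x / 2"]) (simp add: w_def[abs_def])
      qed
    qed simp
    show "w x = 0" if "x \<in> unit_circle" for x
      using that by (simp add: w_def wave_def dot_square_norm)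
    show "\<bar>w x\<bar> \<le> m" if x: "x \<in> unit_disk" for x
    proof -
      have "\<bar>wave h x\<bar> \<le> m * ((1 - x \<bullet> x) / 2)" using wave_bound[OF h m] x by simp
      also have "\<dots> \<le> m * 1"
      proof (rule mult_left_mono[OF _ m0])
        have "(1 - q) / 2 \<le> 1" if "0 \<le> q" for q :: real using that by simp
        then show "(1 - x \<bullet> x) / 2 \<le> 1" using inner_ge_zero by blast
      qed
      finally have "\<bar>cutoff x\<bar> * \<bar>wave h x\<bar> \<le> 1 * m"
        using c1[OF x] m0 power_le_one[OF c1[OF x], of 3]
        by (intro mult_mono) (auto simp: cutoff_def)
      then show ?thesis by (simp add: w_def abs_mult)
    qed
    show "\<exists>D. (w has_derivative D) (at x) \<and> (\<forall>v. \<bar>D v\<bar> \<le> 6 * m * norm v)" if x: "x \<in> unit_disk" for x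
    proof (cases "norm x < 1/2")
      case True
      have "(w has_derivative (\<lambda>v. 0)) (at x)"
        by (rule has_derivative_transform_within_open[OF has_derivative_const[of 0] open_ball[of 0 "1/2"]])
          (use True w_zero in auto)
      then show ?thesis using m0 by (intro exI[of _ "\<lambda>v. 0"]) simp
    next
      case False
      define c where "c = max 0 ((4 * (x \<bullet> x) - 1) / 3)"
      have c: "0 \<le> c" "c \<le> 1" using c1[OF x] by (simp_all add: c_def)
      have n: "1/2 \<le> norm x" "norm x \<le> 1" using False x by auto
      have x2: "1/4 \<le> x \<bullet> x" using power_mono[OF n(1), of 2] by (simp add: dot_square_norm power_divide)
      obtain \<theta> where \<theta>: "x = norm x *\<^sub>R circ \<theta>" using polar by blast
      have x0: "x \<noteq> 0" using n by auto
      define E where "E v = (a (\<theta> + (1 - x \<bullet> x) / 2) * ((rot90 x \<bullet> v) / (x \<bullet> x) - x \<bullet> v)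
       - a (\<theta> - (1 - x \<bullet> x) / 2) * ((rot90 x \<bullet> v) / (x \<bullet> x) + x \<bullet> v)) / 2" for v
      have "(w has_derivative (\<lambda>v. - (c ^ 3 * E v + 8 * c ^ 2 * (x \<bullet> v) * wave h x))) (at x)"
        using wd[OF \<theta> x0] unfolding E_def c_def cutoff_def .
      moreover have "\<bar>- (c ^ 3 * E v + 8 * c ^ 2 * (x \<bullet> v) * wave h x)\<bar> \<le> 6 * m * norm v" for v
      proof -
        have "\<bar>E v\<bar> \<le> 3 * m * norm v" unfolding E_def by (rule wave_derivative_bound[OF m n])
        then have 1: "\<bar>c ^ 3\<bar> * \<bar>E v\<bar> \<le> 1 * (3 * m * norm v)"
          using c power_le_one[OF c, of 3] by (intro mult_mono) auto
        have "\<bar>wave h x\<bar> \<le> m * ((1 - x \<bullet> x) / 2)" using wave_bound[OF h m n(2)] .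
        \<comment> \<open>From |x|^2 at least 1/4; this 3/8 meets the factor 8 from the derivative
          of the cutoff.\<close>
        also have "\<dots> \<le> m * (3/8)" using m0 x2 by (intro mult_left_mono) auto
        finally have F: "\<bar>wave h x\<bar> \<le> m * (3/8)" .
        have "\<bar>x \<bullet> v\<bar> \<le> norm x * norm v" by (rule Cauchy_Schwarz_ineq2)
        also have "\<dots> \<le> norm v" using n(2) mult_right_mono[of "norm x" 1 "norm v"] by simp
        finally have xv: "\<bar>x \<bullet> v\<bar> \<le> norm v" .
        have "\<bar>8 * c ^ 2\<bar> * \<bar>x \<bullet> v\<bar> * \<bar>wave h x\<bar> \<le> 8 * norm v * (m * (3/8))"
          using c power_le_one[OF c, of 2] F xv by (intro mult_mono) auto
        then show ?thesis
          using 1 abs_triangle_ineq[of "c ^ 3 * E v" "8 * c ^ 2 * (x \<bullet> v) * wave h x"]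
          unfolding abs_minus_cancel abs_mult by (simp add: mult_ac)
      qed
      ultimately show ?thesis by blast
    qed
    show "(w has_derivative (\<lambda>v. a \<theta> * (circ \<theta> \<bullet> v))) (at (circ \<theta>))" for \<theta>
    proof -
      have nz: "circ \<theta> \<noteq> 0" using norm_circ[of \<theta>] by (metis norm_zero zero_neq_one)
      have "circ \<theta> = norm (circ \<theta>) *\<^sub>R circ \<theta>" by simp
      \<comment> \<open>On the circle \<open>wave\<close> vanishes and the cutoff is 1, so the
        derivative of the cutoff does not contribute. The angular terms cancel and the radial ones
        add up.\<close>
      from wd[OF this nz] show ?thesis
        by (simp add: wave_def cutoff_def algebra_simps)
    qed
  qed
qed

text \<open>
  \<open>realizable \<alpha> \<beta>\<close>: in the frame (\<open>p\<close>, \<open>rot90 p\<close>) at the boundary points \<open>p = circ \<theta>\<close>, the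
  differential of some diffeomorphism fixing the circle has the columns \<open>(\<alpha>, \<beta>)\<close> and \<open>(0, 1)\<close>.
\<close>

definition realizable :: "(real \<Rightarrow> real) \<Rightarrow> (real \<Rightarrow> real) \<Rightarrow> bool"
  where "realizable \<alpha> \<beta> \<longleftrightarrow> (\<exists>\<psi>. C21_diffeomorphism unit_disk unit_disk \<psi> \<and>
    (\<forall>p\<in>unit_circle. \<psi> p = p) \<and>
    (\<forall>\<theta>. (\<psi> has_derivative
      (\<lambda>v. v + (circ \<theta> \<bullet> v) *\<^sub>R ((\<alpha> \<theta> - 1) *\<^sub>R circ \<theta> + \<beta> \<theta> *\<^sub>R rot90 (circ \<theta>))))
      (at (circ \<theta>) within unit_disk)))"

text \<open>Both maps fix the boundary points, so their differentials there multiply as triangular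
  matrices with columns (\<alpha>, \<beta>) and (0, 1).\<close>

lemma realizable_compose:
  assumes "realizable \<alpha>1 \<beta>1" "realizable \<alpha>2 \<beta>2"
  shows "realizable (\<lambda>\<theta>. \<alpha>1 \<theta> * \<alpha>2 \<theta>) (\<lambda>\<theta>. \<beta>2 \<theta> + \<alpha>2 \<theta> * \<beta>1 \<theta>)"
proof -
  obtain f where f: "C21_diffeomorphism unit_disk unit_disk f" "\<And>p. p \<in> unit_circle \<Longrightarrow> f p = p"
    "\<And>\<theta>. (f has_derivative (\<lambda>v. v + (circ \<theta> \<bullet> v) *\<^sub>R ((\<alpha>1 \<theta> - 1) *\<^sub>R circ \<theta> + \<beta>1 \<theta> *\<^sub>R rot90 (circ \<theta>))))
      (at (circ \<theta>) within unit_disk)"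
    using assms(1) unfolding realizable_def by blast
  obtain g where g: "C21_diffeomorphism unit_disk unit_disk g" "\<And>p. p \<in> unit_circle \<Longrightarrow> g p = p"
    "\<And>\<theta>. (g has_derivative (\<lambda>v. v + (circ \<theta> \<bullet> v) *\<^sub>R ((\<alpha>2 \<theta> - 1) *\<^sub>R circ \<theta> + \<beta>2 \<theta> *\<^sub>R rot90 (circ \<theta>))))
      (at (circ \<theta>) within unit_disk)"
    using assms(2) unfolding realizable_def by blast
  have img: "g ` unit_disk \<subseteq> unit_disk"
    using g(1) by (auto simp: C21_diffeomorphism_def bij_betw_def)
  show ?thesis unfolding realizable_def
  proof (intro exI[of _ "\<lambda>x. f (g x)"] conjI ballI allI)
    show "C21_diffeomorphism unit_disk unit_disk (\<lambda>x. f (g x))"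
      by (rule C21_diffeomorphism_compose[OF _ _ _ _ _ _ g(1) f(1)]) auto
    show "f (g p) = p" if "p \<in> unit_circle" for p using f(2) g(2) that by simp
    fix \<theta>
    have "(f has_derivative (\<lambda>v. v + (circ \<theta> \<bullet> v) *\<^sub>R ((\<alpha>1 \<theta> - 1) *\<^sub>R circ \<theta> + \<beta>1 \<theta> *\<^sub>R rot90 (circ \<theta>))))
      (at (g (circ \<theta>)) within g ` unit_disk)"
      using has_derivative_subset[OF f(3) img] g(2) by simp
    from has_derivative_in_compose[OF g(3) this]
    show "((\<lambda>x. f (g x)) has_derivative (\<lambda>v. v + (circ \<theta> \<bullet> v) *\<^sub>R ((\<alpha>1 \<theta> * \<alpha>2 \<theta> - 1) *\<^sub>R circ \<theta> +
        (\<beta>2 \<theta> + \<alpha>2 \<theta> * \<beta>1 \<theta>) *\<^sub>R rot90 (circ \<theta>)))) (at (circ \<theta>) within unit_disk)"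
      by (rule has_derivative_eq_rhs) (auto simp: fun_eq_iff inner_add_right algebra_simps)
  qed
qed

text \<open>The identity is perturbed by w1 x + w2 Jx. Each summand contributes 1/28 from the size
  of its coefficient and 6/28 from the derivative of that coefficient, in total 14/28 = 1/2, which
  is what \<open>C21_diffeomorphism_perturb_id\<close> allows.\<close>

lemma realizable_small:
  assumes a: "periodic_C11 a" "\<And>\<theta>. \<bar>a \<theta>\<bar> \<le> 1/28" and b: "periodic_C11 b" "\<And>\<theta>. \<bar>b \<theta>\<bar> \<le> 1/28"
  shows "realizable (\<lambda>\<theta>. 1 + a \<theta>) b"
proof -
  obtain w1 where w1: "C21_on unit_disk w1" "\<And>x. x \<in> unit_circle \<Longrightarrow> w1 x = 0"
    "\<And>x. x \<in> unit_disk \<Longrightarrow> \<bar>w1 x\<bar> \<le> 1/28"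
    "\<And>x. x \<in> unit_disk \<Longrightarrow> \<exists>D. (w1 has_derivative D) (at x) \<and> (\<forall>v. \<bar>D v\<bar> \<le> 6 * (1/28) * norm v)"
    "\<And>\<theta>. (w1 has_derivative (\<lambda>v. a \<theta> * (circ \<theta> \<bullet> v))) (at (circ \<theta>))"
    using normal_extension[OF a] by blast
  obtain w2 where w2: "C21_on unit_disk w2" "\<And>x. x \<in> unit_circle \<Longrightarrow> w2 x = 0"
    "\<And>x. x \<in> unit_disk \<Longrightarrow> \<bar>w2 x\<bar> \<le> 1/28"
    "\<And>x. x \<in> unit_disk \<Longrightarrow> \<exists>D. (w2 has_derivative D) (at x) \<and> (\<forall>v. \<bar>D v\<bar> \<le> 6 * (1/28) * norm v)"
    "\<And>\<theta>. (w2 has_derivative (\<lambda>v. b \<theta> * (circ \<theta> \<bullet> v))) (at (circ \<theta>))"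
    using normal_extension[OF b] by blast
  define u where "u x = w1 x *\<^sub>R x + w2 x *\<^sub>R rot90 x" for x
  have rot90d: "(rot90 has_derivative rot90) F" for F
    by (rule bounded_linear_imp_has_derivative[OF bounded_linear_rot90])
  have ud: "(u has_derivative (\<lambda>v. (w1 x *\<^sub>R v + D1 v *\<^sub>R x) + (w2 x *\<^sub>R rot90 v + D2 v *\<^sub>R rot90 x))) (at x)"
    if "(w1 has_derivative D1) (at x)" "(w2 has_derivative D2) (at x)" for x D1 D2
    unfolding u_def by (intro has_derivative_add has_derivative_scaleR has_derivative_ident rot90d that)
  have "C21_on unit_disk u" unfolding u_def[abs_def]
    by (intro C21_on_add C21_on_bilinear[OF bounded_bilinear_scaleR] w1(1) w2(1) C21_on_linear
        bounded_linear_ident bounded_linear_rot90) auto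
  then obtain D where D: "\<And>x. x \<in> unit_disk \<Longrightarrow> (u has_derivative blinfun_apply (D x)) (at x within unit_disk)"
    and D11: "C11_on unit_disk D" unfolding C21_on_def by blast
  \<comment> \<open>\<open>D\<close> is merely some derivative relative to the disk; uniqueness
    identifies it with the explicit one, for which the bounds are known.\<close>
  have Deq: "blinfun_apply (D x) = E" if "x \<in> unit_disk" "(u has_derivative E) (at x)" for x E
    by (rule has_derivative_unique_within_convex[OF _ interior_unit_disk that(1) D[OF that(1)]
        has_derivative_at_withinI[OF that(2)]]) simp
  have Dn: "norm (D x) \<le> 1/2" if x: "x \<in> unit_disk" for x
  proof -
    obtain D1 D2 where D12: "(w1 has_derivative D1) (at x)" "(w2 has_derivative D2) (at x)"
      "\<And>v. \<bar>D1 v\<bar> \<le> 6 * (1/28) * norm v" "\<And>v. \<bar>D2 v\<bar> \<le> 6 * (1/28) * norm v"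
      using w1(4)[OF x] w2(4)[OF x] by blast
    show ?thesis
    proof (rule norm_blinfun_bound)
      fix v
      have x1: "norm x \<le> 1" using x by simp
      have "\<bar>D1 v\<bar> * norm x \<le> (6 * (1/28) * norm v) * 1" "\<bar>D2 v\<bar> * norm x \<le> (6 * (1/28) * norm v) * 1"
        using D12 x1 by (intro mult_mono; simp)+
      moreover have "\<bar>w1 x\<bar> * norm v \<le> 1/28 * norm v" "\<bar>w2 x\<bar> * norm v \<le> 1/28 * norm v"
        using w1(3)[OF x] w2(3)[OF x] by (intro mult_right_mono; simp)+
      moreover have "norm (D x v) \<le> (norm (w1 x *\<^sub>R v) + norm (D1 v *\<^sub>R x)) + (norm (w2 x *\<^sub>R rot90 v) + norm (D2 v *\<^sub>R rot90 x))"
        unfolding Deq[OF x ud[OF D12(1,2)]] by (intro norm_triangle_mono order_refl)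
      ultimately show "norm (D x v) \<le> 1/2 * norm v" unfolding norm_scaleR norm_rot90 by linarith
    qed simp
  qed
  have u0: "u x = 0" if "x \<in> unit_circle" for x using that w1(2) w2(2) by (simp add: u_def)
  have "C21_diffeomorphism unit_disk unit_disk (\<lambda>x. x + u x)"
    by (rule C21_diffeomorphism_perturb_id[OF _ _ D D11 Dn]) (use u0 in auto)
  moreover have "((\<lambda>x. x + u x) has_derivative
      (\<lambda>v. v + (circ \<theta> \<bullet> v) *\<^sub>R ((1 + a \<theta> - 1) *\<^sub>R circ \<theta> + b \<theta> *\<^sub>R rot90 (circ \<theta>))))
      (at (circ \<theta>) within unit_disk)" for \<theta>
  proof -
    have "(u has_derivative (\<lambda>v. (a \<theta> * (circ \<theta> \<bullet> v)) *\<^sub>R circ \<theta> + (b \<theta> * (circ \<theta> \<bullet> v)) *\<^sub>R rot90 (circ \<theta>))) (at (circ \<theta>))"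
      using ud[OF w1(5) w2(5)] w1(2) w2(2) by simp
    from has_derivative_add[OF has_derivative_ident has_derivative_at_withinI[OF this]]
    show ?thesis by (rule has_derivative_eq_rhs) (auto simp: fun_eq_iff algebra_simps)
  qed
  ultimately show ?thesis unfolding realizable_def
    by (intro exI[of _ "\<lambda>x. x + u x"] conjI ballI allI) (simp_all add: u0)
qed

section \<open>Periodic functions and arbitrary boundary data\<close>

lemma periodic_C11_bounded:
  assumes "periodic_C11 a"
  obtains B where "B > 0" "\<And>\<theta>. \<bar>a \<theta>\<bar> \<le> B"
proof -
  have "C11_on {-pi..pi} a" using assms by (simp add: periodic_C11_def)
  then obtain L where L: "L-lipschitz_on {-pi..pi} a" using C11_on_lipschitz[of "{-pi..pi}" a] by auto
  then obtain B where B: "B > 0" "\<And>x. x \<in> {-pi..pi} \<Longrightarrow> norm (a x) \<le> B"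
    using lipschitz_on_bounded_norm[OF bounded_closed_interval L] by blast
  have "\<bar>a \<theta>\<bar> \<le> B" for \<theta>
  proof -
    have pi2_pos: "0 < 2 * pi" by simp
    \<comment> \<open>The number of periods that moves \<open>\<theta>\<close> into
      \<open>{-pi..pi}\<close>.\<close>
    define n where "n = - \<lfloor>(\<theta> + pi) / (2 * pi)\<rfloor>"
    have "of_int \<lfloor>(\<theta> + pi) / (2 * pi)\<rfloor> * (2 * pi) \<le> \<theta> + pi"
      using of_int_floor_le[of "(\<theta> + pi) / (2 * pi)"] by (simp only: pos_le_divide_eq[OF pi2_pos])
    moreover have "\<theta> + pi \<le> (of_int \<lfloor>(\<theta> + pi) / (2 * pi)\<rfloor> + 1) * (2 * pi)"
      using real_of_int_floor_add_one_ge[of "(\<theta> + pi) / (2 * pi)"]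
      by (simp only: pos_divide_le_eq[OF pi2_pos])
    ultimately have "\<theta> + of_int n * (2 * pi) \<in> {-pi..pi}"
      by (auto simp: n_def algebra_simps)
    from B(2)[OF this] show ?thesis unfolding periodic_C11_of_int[OF assms] by simp
  qed
  then show ?thesis using B(1) that by blast
qed

lemma periodic_C11_const: "periodic_C11 (\<lambda>_. c)"
  by (simp add: periodic_C11_def C11_on_const)

lemma periodic_C11_mult:
  assumes "periodic_C11 a" "periodic_C11 b"
  shows "periodic_C11 (\<lambda>\<theta>. a \<theta> * b \<theta>)"
  using assms by (auto simp: periodic_C11_def intro!: C11_on_bilinear[OF bounded_bilinear_mult])

lemma periodic_C11_add:
  assumes "periodic_C11 a" "periodic_C11 b"
  shows "periodic_C11 (\<lambda>\<theta>. a \<theta> + b \<theta>)"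
  using assms by (auto simp: periodic_C11_def intro!: C11_on_add)

text \<open>Restricting the left end to values of \<open>a\<close> admits functions such as
  \<open>ln\<close> and \<open>inverse\<close>, which are regular only on positive intervals, as
  soon as \<open>a\<close> is positive.\<close>

lemma periodic_C11_compose:
  assumes a: "periodic_C11 a" and f: "\<And>l u. l \<in> range a \<Longrightarrow> C11_on {l..u} f"
  shows "periodic_C11 (\<lambda>\<theta>. f (a \<theta>))"
  unfolding periodic_C11_def
proof (intro conjI allI)
  show "f (a (\<theta> + 2 * pi)) = f (a \<theta>)" for \<theta> using a by (simp add: periodic_C11_def)
  fix l u :: real
  show "C11_on {l..u} (\<lambda>\<theta>. f (a \<theta>))"
  proof (cases "l \<le> u")
    case True
    have "continuous_on {l..u} a"
      using periodic_C11_isCont[OF a] by (simp add: continuous_at_imp_continuous_on)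
    then obtain s t where st: "s \<in> {l..u}" "\<And>x. x \<in> {l..u} \<Longrightarrow> a s \<le> a x"
      "t \<in> {l..u}" "\<And>x. x \<in> {l..u} \<Longrightarrow> a x \<le> a t"
      using continuous_attains_inf[of "{l..u}" a] continuous_attains_sup[of "{l..u}" a] True
      by (metis atLeastatMost_empty_iff2 compact_Icc not_less)
    show ?thesis
      by (rule C11_on_compose[of _ "{a s..a t}"]) (use st f a in \<open>auto simp: periodic_C11_def\<close>)
  qed (simp add: C11_on_def, meson lipschitz_on_empty_iff order_refl)
qed

lemma realizable_power:
  assumes "realizable c (\<lambda>_. 0)"
  shows "realizable (\<lambda>\<theta>. c \<theta> ^ Suc n) (\<lambda>_. 0)"
proof (induction n)
  case (Suc n)
  from realizable_compose[OF assms Suc] show ?case by simp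
qed (use assms in simp)

lemma realizable_mult:
  assumes "realizable (\<lambda>_. 1) b"
  shows "realizable (\<lambda>_. 1) (\<lambda>\<theta>. real (Suc n) * b \<theta>)"
proof (induction n)
  case (Suc n)
  from realizable_compose[OF assms Suc] show ?case by (simp add: algebra_simps)
qed (use assms in simp)

text \<open>The data factor into a shear (1, d) and a dilation (exp c, 0). By the composition rule
  the second entry is then exp(c) d, whence d = exp(-c) b. The shear is an N-fold sum and the
  dilation an N-th power of small data; the exponential form makes the N-th root explicit.\<close>

lemma realizable_exp:
  assumes c: "periodic_C11 c" and b: "periodic_C11 b"
  shows "realizable (\<lambda>\<theta>. exp (c \<theta>)) b"
proof -
  obtain C where C: "C > 0" "\<And>\<theta>. \<bar>c \<theta>\<bar> \<le> C" using periodic_C11_bounded[OF c] by blast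
  define d where "d \<theta> = exp (- c \<theta>) * b \<theta>" for \<theta>
  have d: "periodic_C11 d" unfolding d_def
  proof (intro periodic_C11_mult b)
    have "periodic_C11 (\<lambda>\<theta>. -1 * c \<theta>)" by (intro periodic_C11_mult periodic_C11_const c)
    then show "periodic_C11 (\<lambda>\<theta>. exp (- c \<theta>))"
      using periodic_C11_compose[of "\<lambda>\<theta>. -1 * c \<theta>" exp] C11_on_exp by simp
  qed
  obtain B where B: "B > 0" "\<And>\<theta>. \<bar>d \<theta>\<bar> \<le> B" using periodic_C11_bounded[OF d] by blast
  obtain n :: nat where n: "real n > 56 * C" "real n > 28 * B"
    using reals_Archimedean2[of "max (56 * C) (28 * B)"] by auto
  \<comment> \<open>More than 28 B makes d/N small enough; more than 56 C makes |c/N| at most 1/56,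
    which leaves room for exp(c/N) to differ from 1 by at most 1/28.\<close>
  define N where "N = real (Suc n)"
  have N: "N > 0" "N > 56 * C" "N > 28 * B" using n by (simp_all add: N_def)
  have "periodic_C11 (\<lambda>\<theta>. 1 / N * d \<theta>)" by (intro periodic_C11_mult periodic_C11_const d)
  moreover have "\<bar>1 / N * d \<theta>\<bar> \<le> 1/28" for \<theta>
    using N B(2)[of \<theta>] by (simp add: abs_mult field_simps)
  ultimately have "realizable (\<lambda>\<theta>. 1 + 0) (\<lambda>\<theta>. 1 / N * d \<theta>)"
    by (intro realizable_small periodic_C11_const) auto
  then have shear: "realizable (\<lambda>_. 1) d"
    using realizable_mult[of "\<lambda>\<theta>. 1 / N * d \<theta>" n] N unfolding N_def[symmetric] by simp
  have cN: "\<bar>1 / N * c \<theta>\<bar> \<le> 1/56" for \<theta>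
    using N C(2)[of \<theta>] by (simp add: abs_mult field_simps)
  have "periodic_C11 (\<lambda>\<theta>. exp (1 / N * c \<theta>) + - 1)"
    by (intro periodic_C11_add periodic_C11_const
        periodic_C11_compose[of "\<lambda>\<theta>. 1 / N * c \<theta>" exp] periodic_C11_mult c C11_on_exp)
  moreover have "\<bar>exp (1 / N * c \<theta>) + - 1\<bar> \<le> 1/28" for \<theta>
  proof -
    have l: "1 + 1 / N * c \<theta> \<le> exp (1 / N * c \<theta>)" by (rule exp_ge_add_one_self)
    have u: "exp (1 / N * c \<theta>) \<le> 1 / (1 - 1 / N * c \<theta>)"
    proof -
      have "1 - 1 / N * c \<theta> \<le> exp (- (1 / N * c \<theta>))"
        using exp_ge_add_one_self[of "- (1 / N * c \<theta>)"] by simp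
      then have "exp (1 / N * c \<theta>) * (1 - 1 / N * c \<theta>) \<le> exp (1 / N * c \<theta>) * exp (- (1 / N * c \<theta>))"
        by (rule mult_left_mono) simp
      also have "\<dots> = 1" unfolding exp_add[symmetric] by simp
      finally have "exp (1 / N * c \<theta>) * (1 - 1 / N * c \<theta>) \<le> 1" .
      moreover have "1 - 1 / N * c \<theta> > 0" using cN[of \<theta>] by linarith
      ultimately show ?thesis by (simp only: pos_le_divide_eq)
    qed
    have "1 / (1 - y) \<le> 1 + 1/28" if "\<bar>y\<bar> \<le> 1/56" for y :: real
    proof -
      have "1 - y > 0" "1 \<le> (1 + 1/28) * (1 - y)" using that by (simp_all add: algebra_simps abs_le_iff)
      then show ?thesis by (simp only: pos_divide_le_eq)
    qed
    from this[OF cN[of \<theta>]] u l cN[of \<theta>] show ?thesis by linarith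
  qed
  ultimately have "realizable (\<lambda>\<theta>. 1 + (exp (1 / N * c \<theta>) + - 1)) (\<lambda>_. 0)"
    by (intro realizable_small periodic_C11_const) auto
  from realizable_power[OF this, of n]
  have "realizable (\<lambda>\<theta>. exp (c \<theta>)) (\<lambda>_. 0)"
    using N by (simp add: N_def flip: exp_of_nat_mult del: of_nat_Suc power_Suc)
  from realizable_compose[OF shear this] show ?thesis
    by (simp add: d_def mult.assoc[symmetric] flip: exp_add)
qed

subsection \<open>Boundary distance\<close>

lemma vec2_expand: "v = v$1 *\<^sub>R axis 1 1 + v$2 *\<^sub>R axis 2 1" for v :: "real^2"
  unfolding vec2_eq_iff by (simp add: axis_def)

text \<open>A metric is assumed regular only through its components in the standard basis; this
  formula transfers their properties to other arguments.\<close>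

lemma bilinear_expand:
  fixes B :: "real^2 \<Rightarrow> real^2 \<Rightarrow> real"
  assumes "bilinear B"
  shows "B v w = v$1 * w$1 * B (axis 1 1) (axis 1 1) + v$1 * w$2 * B (axis 1 1) (axis 2 1)
    + v$2 * w$1 * B (axis 2 1) (axis 1 1) + v$2 * w$2 * B (axis 2 1) (axis 2 1)"
proof -
  have "B v w = B (v$1 *\<^sub>R axis 1 1 + v$2 *\<^sub>R axis 2 1) (w$1 *\<^sub>R axis 1 1 + w$2 *\<^sub>R axis 2 1)"
    using vec2_expand[of v] vec2_expand[of w] by simp
  also have "\<dots> = v$1 * w$1 * B (axis 1 1) (axis 1 1) + v$1 * w$2 * B (axis 1 1) (axis 2 1)
    + v$2 * w$1 * B (axis 2 1) (axis 1 1) + v$2 * w$2 * B (axis 2 1) (axis 2 1)"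
    by (simp add: bilinear_ladd[OF assms] bilinear_radd[OF assms] bilinear_lmul[OF assms]
        bilinear_rmul[OF assms] algebra_simps)
  finally show ?thesis .
qed

lemma bilinear_Cauchy_Schwarz:
  fixes B :: "'a::real_vector \<Rightarrow> 'a \<Rightarrow> real"
  assumes "bilinear B" and sym: "\<And>v w. B v w = B w v" and pos: "\<And>v. v \<noteq> 0 \<Longrightarrow> 0 < B v v"
  shows "B w v \<le> sqrt (B w w) * sqrt (B v v)"
proof (cases "v = 0")
  case True
  then show ?thesis by (simp add: bilinear_rzero[OF assms(1)])
next
  case False
  have nn: "0 \<le> B u u" for u using pos[of u] by (cases "u = 0") (auto simp: bilinear_rzero[OF assms(1)])
  \<comment> \<open>The coefficient of the orthogonal projection of \<open>w\<close> to
    \<open>v\<close>.\<close>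
  define s where "s = B w v / B v v"
  have "0 \<le> B (w - s *\<^sub>R v) (w - s *\<^sub>R v)" by (rule nn)
  also have "\<dots> = B w w - 2 * s * B w v + s * s * B v v"
    using sym[of v w] by (simp add: bilinear_lsub[OF assms(1)] bilinear_rsub[OF assms(1)]
        bilinear_lmul[OF assms(1)] bilinear_rmul[OF assms(1)] algebra_simps)
  also have "\<dots> = B w w - (B w v)\<^sup>2 / B v v"
    using pos[OF False] by (simp add: s_def power2_eq_square field_simps)
  finally have "(B w v)\<^sup>2 \<le> B w w * B v v" using pos[OF False] by (simp add: field_simps)
  from real_le_rsqrt[OF this] show ?thesis by (simp add: real_sqrt_mult)
qed

context
  fixes g :: "real^2 \<Rightarrow> real^2 \<Rightarrow> real^2 \<Rightarrow> real"
  assumes g: "C11_riemannian_metric unit_disk g"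
begin

section \<open>Uniform bounds for a metric on the disk\<close>

lemma metric_bilinear: "p \<in> unit_disk \<Longrightarrow> bilinear (g p)"
  and metric_sym: "p \<in> unit_disk \<Longrightarrow> g p v w = g p w v"
  and metric_pos: "p \<in> unit_disk \<Longrightarrow> v \<noteq> 0 \<Longrightarrow> 0 < g p v v"
  using g by (auto simp: C11_riemannian_metric_def)

lemma metric_nonneg: "p \<in> unit_disk \<Longrightarrow> 0 \<le> g p v v"
  using metric_pos[of p v] bilinear_rzero[OF metric_bilinear, of p] by (cases "v = 0") auto

lemma C11_on_metric: "C11_on unit_disk (\<lambda>p. g p (axis i 1) (axis j 1))"
  using g by (simp add: C11_riemannian_metric_def axis_in_Basis_iff)

lemma metric_lipschitz:
  obtains C where "C > 0" "\<And>p q v. p \<in> unit_disk \<Longrightarrow> q \<in> unit_disk \<Longrightarrow>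
    g p v v \<le> g q v v + C * norm (p - q) * norm v ^ 2"
proof -
  have "\<exists>L. L-lipschitz_on unit_disk (\<lambda>p. g p (axis i 1) (axis j 1))" for i j
    using C11_on_lipschitz[OF convex_cball bounded_cball C11_on_metric] by metis
  then obtain L where L: "\<And>i j. (L i j)-lipschitz_on unit_disk (\<lambda>p. g p (axis i 1) (axis j 1))"
    by metis
  have L0: "L i j \<ge> 0" for i j using L lipschitz_on_nonneg by blast
  show ?thesis
  \<comment> \<open>One Lipschitz constant for each component; the added 1 makes the sum
    positive.\<close>
  proof (rule that[of "L 1 1 + L 1 2 + L 2 1 + L 2 2 + 1"])
    show "L 1 1 + L 1 2 + L 2 1 + L 2 2 + 1 > 0"
      using L0[of 1 1] L0[of 1 2] L0[of 2 1] L0[of 2 2] by linarith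
    fix p q v :: "real^2" assume p: "p \<in> unit_disk" and q: "q \<in> unit_disk"
    define d where "d = norm (p - q) * norm v ^ 2"
    have d: "d \<ge> 0" by (simp add: d_def)
    have "v$i * v$j * (g p (axis i 1) (axis j 1) - g q (axis i 1) (axis j 1)) \<le> L i j * d" for i j
    proof -
      have "\<bar>v$i * v$j * (g p (axis i 1) (axis j 1) - g q (axis i 1) (axis j 1))\<bar>
        \<le> (norm v * norm v) * (L i j * norm (p - q))"
        unfolding abs_mult using lipschitz_onD[OF L p q, of i j]
        by (intro mult_mono component_le_norm_cart) (auto simp: dist_norm)
      then show ?thesis by (simp add: d_def power2_eq_square mult_ac)
    qed
    from this[of 1 1] this[of 1 2] this[of 2 1] this[of 2 2]
    have "g p v v \<le> g q v v + (L 1 1 + L 1 2 + L 2 1 + L 2 2 + 1) * d"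
      unfolding bilinear_expand[OF metric_bilinear[OF p], of v v] bilinear_expand[OF metric_bilinear[OF q], of v v]
      using d by (simp add: algebra_simps)
    then show "g p v v \<le> g q v v + (L 1 1 + L 1 2 + L 2 1 + L 2 2 + 1) * norm (p - q) * norm v ^ 2"
      by (simp add: d_def mult.assoc)
  qed
qed

text \<open>The form attains a positive minimum on the compact set of points and unit vectors, and
  homogeneity extends the bound to all vectors.\<close>

lemma metric_lower_bound:
  obtains c where "c > 0" "\<And>p v. p \<in> unit_disk \<Longrightarrow> c * norm v \<le> sqrt (g p v v)"
proof -
  define S where "S = unit_disk \<times> unit_circle"
  have gc: "continuous_on unit_disk (\<lambda>p. g p (axis i 1) (axis j 1))" for i j
    using C11_on_lipschitz[OF convex_cball bounded_cball C11_on_metric] lipschitz_on_continuous_on by metis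
  have "continuous_on S (\<lambda>z. snd z$1 * snd z$1 * g (fst z) (axis 1 1) (axis 1 1)
      + snd z$1 * snd z$2 * g (fst z) (axis 1 1) (axis 2 1)
      + snd z$2 * snd z$1 * g (fst z) (axis 2 1) (axis 1 1)
      + snd z$2 * snd z$2 * g (fst z) (axis 2 1) (axis 2 1))"
    by (intro continuous_intros continuous_on_compose2[OF gc]) (auto simp: S_def)
  then have cont: "continuous_on S (\<lambda>z. g (fst z) (snd z) (snd z))"
    by (rule continuous_on_eq)
      (rule bilinear_expand[OF metric_bilinear, symmetric], auto simp: S_def)
  have "compact S" unfolding S_def by (intro compact_Times compact_cball compact_sphere)
  moreover have "S \<noteq> {}" unfolding S_def using circ_mem(2)[of 0] circ_mem(1)[of 0] by blast
  ultimately obtain z where z: "z \<in> S" "\<And>y. y \<in> S \<Longrightarrow> g (fst z) (snd z) (snd z) \<le> g (fst y) (snd y) (snd y)"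
    using continuous_attains_inf[OF _ _ cont] by blast
  define c where "c = g (fst z) (snd z) (snd z)"
  have c: "c > 0" unfolding c_def by (rule metric_pos) (use z(1) in \<open>auto simp: S_def\<close>)
  show ?thesis
  proof (rule that[of "sqrt c"])
    show "sqrt c > 0" using c by simp
    fix p v :: "real^2" assume p: "p \<in> unit_disk"
    have "c * norm v ^ 2 \<le> g p v v"
    proof (cases "v = 0")
      case True
      then show ?thesis using metric_nonneg[OF p] by simp
    next
      case False
      define u where "u = v /\<^sub>R norm v"
      have "(p, u) \<in> S" using p False by (simp add: S_def u_def)
      from z(2)[OF this] have "c \<le> g p u u" by (simp add: c_def)
      also have "\<dots> = g p v v / norm v ^ 2"
        by (simp add: u_def bilinear_lmul[OF metric_bilinear[OF p]] bilinear_rmul[OF metric_bilinear[OF p]]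
            power2_eq_square divide_inverse)
      finally show ?thesis using False by (simp add: field_simps)
    qed
    from real_sqrt_le_mono[OF this] show "sqrt c * norm v \<le> sqrt (g p v v)"
      by (simp add: real_sqrt_mult)
  qed
qed

section \<open>Lengths of curves and distances\<close>

lemma riem_speed_nonneg: "\<gamma> t \<in> unit_disk \<Longrightarrow> 0 \<le> riem_speed g \<gamma> t"
  by (simp add: riem_speed_def Let_def metric_nonneg)

lemma riem_curve_mem: "\<gamma> \<in> riem_curves unit_disk g x y \<Longrightarrow> t \<in> {0..1} \<Longrightarrow> \<gamma> t \<in> unit_disk"
  unfolding riem_curves_def path_image_def by blast

lemma riem_length_nonneg: "\<gamma> \<in> riem_curves unit_disk g x y \<Longrightarrow> 0 \<le> riem_length g \<gamma>"
  unfolding riem_length_def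
  by (rule integral_nonneg) (auto simp: riem_curves_def path_image_def image_subset_iff intro!: riem_speed_nonneg)

lemma bdd_below_riem_length: "bdd_below (riem_length g ` riem_curves unit_disk g x y)"
  by (rule bdd_belowI2[of _ 0]) (rule riem_length_nonneg)

text \<open>A calibration argument: \<open>l\<close> applied to the displacement is the integral of
  \<open>l\<close> along the velocity, which the hypothesis bounds by the speed. All lower bounds
  for lengths come from this, with suitable \<open>l\<close>.\<close>

lemma linear_functional_le_length:
  assumes \<gamma>: "\<gamma> \<in> riem_curves unit_disk g x y" and l: "bounded_linear l" and t: "t \<in> {0..1}"
    and le: "\<And>s v. s \<in> {0..1} \<Longrightarrow> l v \<le> M * sqrt (g (\<gamma> s) v v)" and M: "M \<ge> 0"
  shows "l (\<gamma> t - x) \<le> M * riem_length g \<gamma>"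
proof -
  interpret l: bounded_linear l by fact
  have vp: "valid_path \<gamma>" and int: "riem_speed g \<gamma> integrable_on {0..1}" and x: "\<gamma> 0 = x"
    using \<gamma> by (auto simp: riem_curves_def pathstart_def)
  then obtain S D where S: "finite S" and D: "\<And>s. s \<in> {0..1} - S \<Longrightarrow> (\<gamma> has_vector_derivative D s) (at s)"
    and cont: "continuous_on {0..1} \<gamma>"
    unfolding valid_path_def piecewise_C1_differentiable_on_def C1_differentiable_on_def by metis
  define v where "v s = vector_derivative \<gamma> (at s within {0..1})" for s
  have v: "(\<gamma> has_vector_derivative v s) (at s)" if "s \<in> {0<..<1} - S" for s
  proof -
    have "(\<gamma> has_vector_derivative D s) (at s)" using D that by auto
    moreover have "at s within {0..1} = at s" using that by (simp add: at_within_Icc_at)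
    ultimately show ?thesis unfolding v_def by (simp add: vector_derivative_at)
  qed
  have "((\<lambda>s. l (v s)) has_integral (l (\<gamma> t) - l (\<gamma> 0))) {0..t}"
  \<comment> \<open>A valid path has a derivative only off a finite set; continuity bridges the
    exceptional parameters and the ends.\<close>
  proof (rule fundamental_theorem_of_calculus_interior_strong[OF S])
    show "0 \<le> t" using t by simp
    show "((\<lambda>s. l (\<gamma> s)) has_vector_derivative l (v s)) (at s)" if "s \<in> {0<..<t} - S" for s
      using bounded_linear.has_vector_derivative[OF l v] that t by auto
    show "continuous_on {0..t} (\<lambda>s. l (\<gamma> s))"
      using t by (intro l.continuous_on continuous_on_subset[OF cont]) auto
  qed
  moreover have int_t: "riem_speed g \<gamma> integrable_on {0..t}"
    using int t by (rule_tac integrable_subinterval_real) auto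
  ultimately have "l (\<gamma> t) - l (\<gamma> 0) \<le> M * integral {0..t} (riem_speed g \<gamma>)"
  proof (rule_tac has_integral_le)
    show "((\<lambda>s. M * riem_speed g \<gamma> s) has_integral (M * integral {0..t} (riem_speed g \<gamma>))) {0..t}"
      using int_t by (intro has_integral_mult_right integrable_integral)
    show "l (v s) \<le> M * riem_speed g \<gamma> s" if "s \<in> {0..t}" for s
      using le[of s "v s"] that t by (simp add: riem_speed_def v_def Let_def)
  qed
  also have "\<dots> \<le> M * riem_length g \<gamma>"
    unfolding riem_length_def using t int int_t M riem_speed_nonneg riem_curve_mem[OF \<gamma>]
    by (intro mult_left_mono integral_subset_le) auto
  finally show ?thesis by (simp add: l.diff x)
qed

text \<open>Chords are admissible because the disk is convex and their speed is continuous. Thus the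
  infimum defining the distance is taken over a nonempty set, and chords bound it from
  above.\<close>

lemma linepath_riem_curve:
  assumes "x \<in> unit_disk" "y \<in> unit_disk"
  shows "linepath x y \<in> riem_curves unit_disk g x y"
    and "t \<in> {0..1} \<Longrightarrow> riem_speed g (linepath x y) t = sqrt (g (linepath x y t) (y - x) (y - x))"
proof -
  show sp: "riem_speed g (linepath x y) t = sqrt (g (linepath x y t) (y - x) (y - x))" if "t \<in> {0..1}" for t
    using that by (simp add: riem_speed_def Let_def vector_derivative_linepath_within)
  have sub: "closed_segment x y \<subseteq> unit_disk"
    using assms by (intro closed_segment_subset convex_cball)
  then have mem: "linepath x y t \<in> unit_disk" if "t \<in> {0..1}" for t
    using linepath_in_path[OF that] sub by blast
  have gc: "continuous_on unit_disk (\<lambda>p. g p (axis i 1) (axis j 1))" for i j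
    using C11_on_lipschitz[OF convex_cball bounded_cball C11_on_metric] lipschitz_on_continuous_on by metis
  have lc: "continuous_on {0..1} (\<lambda>t. g (linepath x y t) (axis i 1) (axis j 1))" for i j
    by (rule continuous_on_compose2[OF gc continuous_on_linepath]) (use mem in blast)
  define w where "w = y - x"
  have "continuous_on {0..1} (\<lambda>t. w$1 * w$1 * g (linepath x y t) (axis 1 1) (axis 1 1)
      + w$1 * w$2 * g (linepath x y t) (axis 1 1) (axis 2 1)
      + w$2 * w$1 * g (linepath x y t) (axis 2 1) (axis 1 1)
      + w$2 * w$2 * g (linepath x y t) (axis 2 1) (axis 2 1))"
    by (intro continuous_intros lc)
  then have "continuous_on {0..1} (\<lambda>t. g (linepath x y t) w w)"
    by (rule continuous_on_eq) (rule bilinear_expand[OF metric_bilinear[OF mem], symmetric])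
  then have "continuous_on {0..1} (\<lambda>t. sqrt (g (linepath x y t) (y - x) (y - x)))"
    unfolding w_def by (rule continuous_on_real_sqrt)
  then have "(\<lambda>t. sqrt (g (linepath x y t) (y - x) (y - x))) integrable_on {0..1}"
    by (rule integrable_continuous_real)
  then have "riem_speed g (linepath x y) integrable_on {0..1}"
    using sp by (metis (mono_tags, lifting) integrable_cong)
  then show "linepath x y \<in> riem_curves unit_disk g x y"
    unfolding riem_curves_def using sub by (simp add: valid_path_linepath)
qed

lemma riem_dist_nonneg:
  assumes "x \<in> unit_disk" "y \<in> unit_disk" shows "0 \<le> riem_dist unit_disk g x y"
  unfolding riem_dist_def using linepath_riem_curve(1)[OF assms] riem_length_nonneg
  by (intro cINF_greatest) auto

text \<open>The chord is measured with the metric frozen at \<open>x\<close>. Along it the point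
  moves by at most |y - x|, so the squared speed changes by at most C |y - x|^3.\<close>

lemma riem_dist_upper:
  assumes C: "\<And>p q v. p \<in> unit_disk \<Longrightarrow> q \<in> unit_disk \<Longrightarrow>
    g p v v \<le> g q v v + C * norm (p - q) * norm v ^ 2" "C > 0"
    and x: "x \<in> unit_disk" and y: "y \<in> unit_disk"
  shows "riem_dist unit_disk g x y \<le> sqrt (g x (y - x) (y - x) + C * norm (y - x) ^ 3)"
proof -
  have mem: "linepath x y t \<in> unit_disk" if "t \<in> {0..1}" for t
    using riem_curve_mem[OF linepath_riem_curve(1)[OF x y] that] .
  have "riem_dist unit_disk g x y \<le> riem_length g (linepath x y)"
    unfolding riem_dist_def by (rule cINF_lower[OF bdd_below_riem_length linepath_riem_curve(1)[OF x y]])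
  also have "\<dots> \<le> integral {0..1} (\<lambda>_::real. sqrt (g x (y - x) (y - x) + C * norm (y - x) ^ 3))"
    unfolding riem_length_def
  proof (rule integral_le)
    show "riem_speed g (linepath x y) integrable_on {0..1}"
      using linepath_riem_curve(1)[OF x y] by (simp add: riem_curves_def)
    fix t :: real assume t: "t \<in> {0..1}"
    have "norm (linepath x y t - x) \<le> norm (y - x)"
    proof -
      have "linepath x y t - x = t *\<^sub>R (y - x)" by (simp add: linepath_def algebra_simps)
      then show ?thesis using t mult_right_mono[of t 1 "norm (y - x)"] by simp
    qed
    then have "C * norm (linepath x y t - x) * norm (y - x) ^ 2 \<le> C * norm (y - x) * norm (y - x) ^ 2"
      using C(2) by (intro mult_right_mono mult_left_mono) auto
    then have "g (linepath x y t) (y - x) (y - x) \<le> g x (y - x) (y - x) + C * norm (y - x) ^ 3"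
      using C(1)[OF mem[OF t] x, of "y - x"] by (simp add: power2_eq_square power3_eq_cube mult_ac)
    then show "riem_speed g (linepath x y) t \<le> sqrt (g x (y - x) (y - x) + C * norm (y - x) ^ 3)"
      unfolding linepath_riem_curve(2)[OF x y t] by (rule real_sqrt_le_mono)
  qed auto
  finally show ?thesis by simp
qed

text \<open>A short curve stays near \<open>x\<close>, where the metric is close to its value at
  \<open>x\<close>; for that constant metric no curve is shorter than the chord. Both facts are
  obtained by calibration.\<close>

lemma riem_length_lower:
  assumes C: "\<And>p q v. p \<in> unit_disk \<Longrightarrow> q \<in> unit_disk \<Longrightarrow>
    g p v v \<le> g q v v + C * norm (p - q) * norm v ^ 2" "C > 0"
    and c: "\<And>p v. p \<in> unit_disk \<Longrightarrow> c * norm v \<le> sqrt (g p v v)" "c > 0"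
    and x: "x \<in> unit_disk" and \<gamma>: "\<gamma> \<in> riem_curves unit_disk g x y"
  shows "g x (y - x) (y - x) \<le> (1 + C / c ^ 3 * riem_length g \<gamma>) * riem_length g \<gamma> ^ 2"
proof -
  define L where "L = riem_length g \<gamma>"
  have L: "L \<ge> 0" unfolding L_def using riem_length_nonneg[OF \<gamma>] .
  have mem: "\<gamma> t \<in> unit_disk" if "t \<in> {0..1}" for t using riem_curve_mem[OF \<gamma> that] .
  \<comment> \<open>Calibration by the inner product with the displacement itself.\<close>
  have near: "norm (\<gamma> t - x) \<le> L / c" if t: "t \<in> {0..1}" for t
  proof -
    define e where "e = \<gamma> t - x"
    have "e \<bullet> v \<le> norm e / c * sqrt (g (\<gamma> s) v v)" if "s \<in> {0..1}" for s v
    proof -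
      have "e \<bullet> v \<le> norm e * norm v" using Cauchy_Schwarz_ineq2[of e v] by linarith
      also have "\<dots> \<le> norm e * (sqrt (g (\<gamma> s) v v) / c)"
        using c(1)[OF mem[OF that], of v] c(2) by (intro mult_left_mono) (auto simp: field_simps)
      finally show ?thesis by simp
    qed
    then have "e \<bullet> (\<gamma> t - x) \<le> norm e / c * L"
      unfolding L_def using c(2) by (intro linear_functional_le_length[OF \<gamma> bounded_linear_inner_right t]) auto
    then have "norm e * norm e \<le> norm e * (L / c)"
      unfolding e_def[symmetric] by (simp add: dot_square_norm power2_eq_square)
    then show ?thesis unfolding e_def[symmetric] using L c(2)
      by (cases "e = 0") (auto intro: mult_left_le_imp_le[of "norm e"])
  qed
  define K where "K = C / c ^ 3"
  have K: "K \<ge> 0" using C(2) c(2) by (simp add: K_def)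
  define w where "w = y - x"
  define N where "N = sqrt (g x w w)"
  have "N \<ge> 0" using metric_nonneg[OF x] by (simp add: N_def)
  \<comment> \<open>\<open>K\<close> is C / c^3: one c comes from the distance bound L/c, two from
    replacing |v|^2 by the metric.\<close>
  have comp: "g x v v \<le> (1 + K * L) * g (\<gamma> s) v v" if s: "s \<in> {0..1}" for s v
  proof -
    have "(c * norm v)\<^sup>2 \<le> (sqrt (g (\<gamma> s) v v))\<^sup>2"
      using c(1)[OF mem[OF s], of v] c(2) by (intro power_mono) auto
    then have 1: "norm v ^ 2 \<le> g (\<gamma> s) v v / c\<^sup>2"
      using metric_nonneg[OF mem[OF s]] c(2) by (simp add: power_mult_distrib field_simps)
    have "C * norm (x - \<gamma> s) * norm v ^ 2 \<le> C * (L / c) * (g (\<gamma> s) v v / c\<^sup>2)"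
      using near[OF s] 1 C(2) L c(2) by (intro mult_mono) (auto simp: norm_minus_commute)
    also have "\<dots> = K * L * g (\<gamma> s) v v"
      by (simp add: K_def power2_eq_square power3_eq_cube)
    finally show ?thesis using C(1)[OF x mem[OF s], of v] by (simp add: algebra_simps)
  qed
  have "g x w v \<le> N * sqrt (1 + K * L) * sqrt (g (\<gamma> s) v v)" if s: "s \<in> {0..1}" for s v
  proof -
    have "g x w v \<le> N * sqrt (g x v v)" unfolding N_def
      by (rule bilinear_Cauchy_Schwarz[OF metric_bilinear[OF x] metric_sym[OF x] metric_pos[OF x]])
    also have "\<dots> \<le> N * sqrt ((1 + K * L) * g (\<gamma> s) v v)"
      using comp[OF s] metric_nonneg[OF x] by (intro mult_left_mono) (auto simp: N_def)
    finally show ?thesis by (simp add: real_sqrt_mult)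
  qed
  moreover have "bounded_linear (g x w)"
    using metric_bilinear[OF x] by (simp add: bilinear_def linear_conv_bounded_linear)
  moreover have "N * sqrt (1 + K * L) \<ge> 0" using K L metric_nonneg[OF x] by (simp add: N_def)
  ultimately have "g x w (\<gamma> 1 - x) \<le> N * sqrt (1 + K * L) * L"
    unfolding L_def by (intro linear_functional_le_length[OF \<gamma>]) auto
  moreover have "\<gamma> 1 - x = w" using \<gamma> by (simp add: w_def riem_curves_def pathfinish_def)
  moreover have "g x w w = N * N" using metric_nonneg[OF x] by (simp add: N_def)
  ultimately have "N * N \<le> N * (sqrt (1 + K * L) * L)" by (simp add: mult_ac)
  then have "N \<le> sqrt (1 + K * L) * L"
    using L K \<open>N \<ge> 0\<close> by (cases "N = 0") (auto intro: mult_left_le_imp_le[of N])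
  then have "N\<^sup>2 \<le> (sqrt (1 + K * L) * L)\<^sup>2"
    using \<open>N \<ge> 0\<close> by (rule power_mono)
  moreover have "(sqrt (1 + K * L))\<^sup>2 = 1 + K * L" using K L by simp
  moreover have "N\<^sup>2 = g x w w" using metric_nonneg[OF x] by (simp add: N_def)
  ultimately show ?thesis
    unfolding K_def w_def L_def by (simp only: power_mult_distrib)
qed

text \<open>The bound for single curves is increasing in the length, so it passes to the infimum
  along curves of length below d + 1/(n+1).\<close>

lemma riem_dist_lower:
  assumes C: "\<And>p q v. p \<in> unit_disk \<Longrightarrow> q \<in> unit_disk \<Longrightarrow>
    g p v v \<le> g q v v + C * norm (p - q) * norm v ^ 2" "C > 0"
    and c: "\<And>p v. p \<in> unit_disk \<Longrightarrow> c * norm v \<le> sqrt (g p v v)" "c > 0"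
    and x: "x \<in> unit_disk" and y: "y \<in> unit_disk"
  shows "g x (y - x) (y - x) \<le> (1 + C / c ^ 3 * riem_dist unit_disk g x y) * riem_dist unit_disk g x y ^ 2"
proof -
  define K where "K = C / c ^ 3"
  have K: "K \<ge> 0" using C(2) c(2) by (simp add: K_def)
  define d where "d = riem_dist unit_disk g x y"
  have ne: "riem_curves unit_disk g x y \<noteq> {}" using linepath_riem_curve(1)[OF x y] by blast
  have "g x (y - x) (y - x) \<le> (1 + K * (d + inverse (Suc n))) * (d + inverse (Suc n)) ^ 2" for n
  proof -
    have "riem_dist unit_disk g x y < d + inverse (Suc n)" by (simp add: d_def)
    then obtain \<gamma> where \<gamma>: "\<gamma> \<in> riem_curves unit_disk g x y" "riem_length g \<gamma> < d + inverse (Suc n)"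
      unfolding riem_dist_def cINF_less_iff[OF ne bdd_below_riem_length] by blast
    have "g x (y - x) (y - x) \<le> (1 + K * riem_length g \<gamma>) * riem_length g \<gamma> ^ 2"
      unfolding K_def by (rule riem_length_lower[OF C c x \<gamma>(1)])
    also have "\<dots> \<le> (1 + K * (d + inverse (Suc n))) * (d + inverse (Suc n)) ^ 2"
      using \<gamma>(2) riem_length_nonneg[OF \<gamma>(1)] K
      by (intro mult_mono add_left_mono mult_left_mono power_mono) auto
    finally show ?thesis .
  qed
  moreover have "(\<lambda>n. (1 + K * (d + inverse (Suc n))) * (d + inverse (Suc n)) ^ 2)
      \<longlonglongrightarrow> (1 + K * (d + 0)) * (d + 0) ^ 2"
    by (intro tendsto_intros LIMSEQ_inverse_real_of_nat)
  ultimately show ?thesis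
    unfolding K_def[symmetric] d_def[symmetric] by (intro LIMSEQ_le_const) auto
qed

end

text \<open>For nearby boundary points the lower bound for the first distance and the upper bound
  for the second sandwich the common value. Dividing by the squared angle \<open>s\<close> and
  letting it tend to 0 turns the chord into the tangent vector and removes all error terms.\<close>

lemma tangential_le:
  assumes g1: "C11_riemannian_metric unit_disk g1" and g2: "C11_riemannian_metric unit_disk g2"
    and eq: "\<And>x y. x \<in> unit_circle \<Longrightarrow> y \<in> unit_circle \<Longrightarrow>
      riem_dist unit_disk g1 x y = riem_dist unit_disk g2 x y"
  shows "g1 (circ \<theta>) (rot90 (circ \<theta>)) (rot90 (circ \<theta>)) \<le> g2 (circ \<theta>) (rot90 (circ \<theta>)) (rot90 (circ \<theta>))"
proof -
  define x where "x = circ \<theta>"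
  have x: "x \<in> unit_disk" by (simp add: x_def)
  obtain C where C: "\<And>p q v. p \<in> unit_disk \<Longrightarrow> q \<in> unit_disk \<Longrightarrow>
    g1 p v v \<le> g1 q v v + C * norm (p - q) * norm v ^ 2" "C > 0" using metric_lipschitz[OF g1] by metis
  obtain c where c: "\<And>p v. p \<in> unit_disk \<Longrightarrow> c * norm v \<le> sqrt (g1 p v v)" "c > 0"
    using metric_lower_bound[OF g1] by metis
  obtain E where E: "\<And>p q v. p \<in> unit_disk \<Longrightarrow> q \<in> unit_disk \<Longrightarrow>
    g2 p v v \<le> g2 q v v + E * norm (p - q) * norm v ^ 2" "E > 0" using metric_lipschitz[OF g2] by metis
  define K where "K = C / c ^ 3"
  have K: "K \<ge> 0" using C(2) c(2) by (simp add: K_def)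
  define z where "z s = (1 / s) *\<^sub>R (circ (\<theta> + s) - circ \<theta>)" for s
  have z: "(z \<longlongrightarrow> rot90 x) (at_right 0)"
  proof -
    have "((\<lambda>h. norm (circ (\<theta> + h) - circ \<theta> - h *\<^sub>R rot90 (circ \<theta>)) / norm h) \<longlongrightarrow> 0) (at 0)"
      using circ_has_derivative[of \<theta> UNIV] by (simp add: has_derivative_at)
    then have "((\<lambda>h. norm (circ (\<theta> + h) - circ \<theta> - h *\<^sub>R rot90 (circ \<theta>)) / norm h) \<longlongrightarrow> 0) (at_right 0)"
      by (rule tendsto_within_subset) simp
    moreover have "\<forall>\<^sub>F h in at_right 0. norm (circ (\<theta> + h) - circ \<theta> - h *\<^sub>R rot90 (circ \<theta>)) / norm h = norm (z h - rot90 x)"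
    proof (rule eventually_at_right_less[THEN eventually_mono])
      fix h :: real assume "0 < h"
      then have "z h - rot90 x = (1 / h) *\<^sub>R (circ (\<theta> + h) - circ \<theta> - h *\<^sub>R rot90 (circ \<theta>))"
        by (simp add: z_def x_def algebra_simps)
      then show "norm (circ (\<theta> + h) - circ \<theta> - h *\<^sub>R rot90 (circ \<theta>)) / norm h = norm (z h - rot90 x)"
        by simp
    qed
    ultimately have "((\<lambda>h. norm (z h - rot90 x)) \<longlongrightarrow> 0) (at_right 0)"
      by (rule Lim_transform_eventually)
    then show ?thesis by (simp add: tendsto_norm_zero_iff LIM_zero_iff)
  qed
  have lim: "((\<lambda>s. B (z s) (z s)) \<longlongrightarrow> B (rot90 x) (rot90 x)) (at_right 0)"
    if "bilinear B" for B :: "real^2 \<Rightarrow> real^2 \<Rightarrow> real"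
    using bounded_bilinear.tendsto[OF _ z z] that by (simp add: bilinear_conv_bounded_bilinear)
  \<comment> \<open>The upper bound for the squared distance, divided by the square of
    \<open>s\<close>.\<close>
  define R where "R s = g2 x (z s) (z s) + E * norm (z s) ^ 3 * s" for s
  have R: "(R \<longlongrightarrow> g2 x (rot90 x) (rot90 x) + E * norm (rot90 x) ^ 3 * 0) (at_right 0)"
    unfolding R_def by (intro tendsto_intros lim metric_bilinear[OF g2 x] z)
  have "((\<lambda>s. (1 + K * (s * sqrt (R s))) * R s) \<longlongrightarrow>
      (1 + K * (0 * sqrt (g2 x (rot90 x) (rot90 x) + E * norm (rot90 x) ^ 3 * 0))) * (g2 x (rot90 x) (rot90 x) + E * norm (rot90 x) ^ 3 * 0)) (at_right 0)"
    by (intro tendsto_intros R)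
  then have "((\<lambda>s. (1 + K * (s * sqrt (R s))) * R s) \<longlongrightarrow> g2 x (rot90 x) (rot90 x)) (at_right 0)" by simp
  moreover have "((\<lambda>s. g1 x (z s) (z s)) \<longlongrightarrow> g1 x (rot90 x) (rot90 x)) (at_right 0)"
    by (rule lim[OF metric_bilinear[OF g1 x]])
  moreover have "\<forall>\<^sub>F s in at_right 0. g1 x (z s) (z s) \<le> (1 + K * (s * sqrt (R s))) * R s"
  proof (rule eventually_at_right_less[THEN eventually_mono])
    fix s :: real assume s: "0 < s"
    define y where "y = circ (\<theta> + s)"
    have y: "y \<in> unit_disk" by (simp add: y_def)
    have w: "y - x = s *\<^sub>R z s" using s by (simp add: z_def x_def y_def)
    define d where "d = riem_dist unit_disk g2 x y"
    have d0: "d \<ge> 0" unfolding d_def by (rule riem_dist_nonneg[OF g2 x y])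
    have sc: "g x (y - x) (y - x) = s\<^sup>2 * g x (z s) (z s)" if "C11_riemannian_metric unit_disk g" for g
      unfolding w using metric_bilinear[OF that x]
      by (simp add: bilinear_lmul bilinear_rmul power2_eq_square)
    have Rs: "R s \<ge> 0" using metric_nonneg[OF g2 x] E(2) s by (simp add: R_def)
    have "d \<le> sqrt (g2 x (y - x) (y - x) + E * norm (y - x) ^ 3)"
      unfolding d_def by (rule riem_dist_upper[OF g2 E x y])
    also have "g2 x (y - x) (y - x) + E * norm (y - x) ^ 3 = s\<^sup>2 * R s"
      unfolding sc[OF g2] using s by (simp add: w R_def power_mult_distrib power2_eq_square power3_eq_cube algebra_simps)
    also have "sqrt (s\<^sup>2 * R s) = s * sqrt (R s)" using s by (simp add: real_sqrt_mult)
    finally have d: "d \<le> s * sqrt (R s)" .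
    have "g1 x (y - x) (y - x) \<le> (1 + K * d) * d\<^sup>2"
      using riem_dist_lower[OF g1 C c x y] eq[of x y] by (simp add: d_def K_def x_def y_def)
    also have "\<dots> \<le> (1 + K * (s * sqrt (R s))) * (s * sqrt (R s))\<^sup>2"
      using d d0 K s Rs by (intro mult_mono add_left_mono mult_left_mono power_mono) auto
    also have "\<dots> = s\<^sup>2 * ((1 + K * (s * sqrt (R s))) * R s)"
      using Rs by (simp add: power_mult_distrib)
    finally show "g1 x (z s) (z s) \<le> (1 + K * (s * sqrt (R s))) * R s"
      unfolding sc[OF g1] using s by simp
  qed
  ultimately show ?thesis unfolding x_def[symmetric]
    by (intro tendsto_le[OF trivial_limit_at_right_real]) auto
qed

lemma tangential_eq:
  assumes g1: "C11_riemannian_metric unit_disk g1" and g2: "C11_riemannian_metric unit_disk g2"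
    and eq: "\<forall>x\<in>unit_circle. \<forall>y\<in>unit_circle. riem_dist unit_disk g1 x y = riem_dist unit_disk g2 x y"
  shows "g1 (circ \<theta>) (rot90 (circ \<theta>)) (rot90 (circ \<theta>)) = g2 (circ \<theta>) (rot90 (circ \<theta>)) (rot90 (circ \<theta>))"
proof (rule antisym)
  show "g1 (circ \<theta>) (rot90 (circ \<theta>)) (rot90 (circ \<theta>)) \<le> g2 (circ \<theta>) (rot90 (circ \<theta>)) (rot90 (circ \<theta>))"
    by (rule tangential_le[OF g1 g2]) (use eq in blast)
  show "g2 (circ \<theta>) (rot90 (circ \<theta>)) (rot90 (circ \<theta>)) \<le> g1 (circ \<theta>) (rot90 (circ \<theta>)) (rot90 (circ \<theta>))"
    by (rule tangential_le[OF g2 g1]) (use eq in force)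
qed

subsection \<open>Matching the metrics\<close>

lemma C11_on_cos: "C11_on {l..u} (cos :: real \<Rightarrow> real)"
  by (rule C11_on_realI2[of _ _ _ "\<lambda>t. - sin t" "\<lambda>t. - cos t"])
    (auto intro!: continuous_intros derivative_eq_intros)

lemma C11_on_sin: "C11_on {l..u} (sin :: real \<Rightarrow> real)"
  by (rule C11_on_realI2[of _ _ _ cos "\<lambda>t. - sin t"])
    (auto intro!: continuous_intros derivative_eq_intros)

lemma C11_on_circ: "C11_on {l..u} circ"
proof -
  have "C11_on {l..u} (\<lambda>\<theta>. cos \<theta> *\<^sub>R (vector [1, 0] :: real^2) + sin \<theta> *\<^sub>R vector [0, 1])"
    by (intro C11_on_add C11_on_bilinear[OF bounded_bilinear_scaleR] C11_on_cos C11_on_sin C11_on_const) auto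
  then show ?thesis by (rule C11_on_cong) (simp add: vec2_eq_iff)
qed

lemma periodic_C11_cos: "periodic_C11 cos" and periodic_C11_sin: "periodic_C11 sin"
  by (simp_all add: periodic_C11_def C11_on_cos C11_on_sin)

lemma periodic_C11_restrict_circ:
  assumes "C11_on unit_disk f" shows "periodic_C11 (\<lambda>\<theta>. f (circ \<theta>))"
  unfolding periodic_C11_def
proof (intro conjI allI)
  show "C11_on {l..u} (\<lambda>\<theta>. f (circ \<theta>))" for l u
    by (rule C11_on_compose[OF _ _ _ _ assms C11_on_circ]) auto
qed simp

lemma periodic_C11_minus: "periodic_C11 a \<Longrightarrow> periodic_C11 (\<lambda>\<theta>. - a \<theta>)"
  using periodic_C11_mult[OF periodic_C11_const[of "-1"], of a] by simp

lemma periodic_C11_metric: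
  assumes g: "C11_riemannian_metric unit_disk g"
    and A: "periodic_C11 (\<lambda>\<theta>. A \<theta> $ 1)" "periodic_C11 (\<lambda>\<theta>. A \<theta> $ 2)"
    and B: "periodic_C11 (\<lambda>\<theta>. B \<theta> $ 1)" "periodic_C11 (\<lambda>\<theta>. B \<theta> $ 2)"
  shows "periodic_C11 (\<lambda>\<theta>. g (circ \<theta>) (A \<theta>) (B \<theta>))"
  unfolding bilinear_expand[OF metric_bilinear[OF g circ_mem(1)], of _ "A _" "B _"]
  by (intro periodic_C11_add periodic_C11_mult A B
      periodic_C11_restrict_circ[OF C11_on_metric[OF g]])

lemma bilinear_frame:
  fixes B :: "'a::real_vector \<Rightarrow> 'a \<Rightarrow> real"
  assumes B: "bilinear B" and sym: "\<And>v w. B v w = B w v"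
  shows "B (a *\<^sub>R p + b *\<^sub>R q) (c *\<^sub>R p + d *\<^sub>R q)
    = a * c * B p p + (a * d + b * c) * B p q + b * d * B q q"
  by (simp add: bilinear_ladd[OF B] bilinear_radd[OF B] bilinear_lmul[OF B]
      bilinear_rmul[OF B] sym[of q p] algebra_simps)

text \<open>The determinant is \<open>B q q\<close> times the squared length of the component of
  \<open>p\<close> orthogonal to \<open>q\<close>; this component is nonzero by
  independence.\<close>

lemma gram_det_pos:
  fixes B :: "'a::real_vector \<Rightarrow> 'a \<Rightarrow> real"
  assumes B: "bilinear B" and sym: "\<And>v w. B v w = B w v" and pos: "\<And>v. v \<noteq> 0 \<Longrightarrow> 0 < B v v"
    and q: "q \<noteq> 0" and indep: "\<And>s. p + s *\<^sub>R q \<noteq> 0"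
  shows "0 < B p p * B q q - B p q * B p q"
proof -
  define s where "s = - B p q / B q q"
  have G: "B q q > 0" by (rule pos[OF q])
  have "0 < B (p + s *\<^sub>R q) (p + s *\<^sub>R q)" by (rule pos[OF indep])
  also have "\<dots> = B p p + 2 * s * B p q + s * s * B q q"
    using bilinear_frame[OF B sym, of 1 p s q 1 s] by simp
  also have "\<dots> = (B p p * B q q - B p q * B p q) / B q q"
    using G by (simp add: s_def field_simps)
  finally show ?thesis using G by (simp add: zero_less_divide_iff)
qed

lemma rot90_circ_nonzero: "rot90 (circ \<theta>) \<noteq> 0"
proof
  assume "rot90 (circ \<theta>) = 0"
  then have "norm (rot90 (circ \<theta>)) = 0" by simp
  then show False unfolding norm_rot90 by simp
qed

lemma circ_add_rot90_nonzero: "circ \<theta> + s *\<^sub>R rot90 (circ \<theta>) \<noteq> 0"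
proof
  assume "circ \<theta> + s *\<^sub>R rot90 (circ \<theta>) = 0"
  then have "circ \<theta> \<bullet> (circ \<theta> + s *\<^sub>R rot90 (circ \<theta>)) = 0" by simp
  then show False by (simp add: inner_add_right)
qed

theorem theorem1:
  fixes g1 g2 :: "real^2 \<Rightarrow> real^2 \<Rightarrow> real^2 \<Rightarrow> real"
  assumes "C11_riemannian_metric unit_disk g1"
    and "C11_riemannian_metric unit_disk g2"
    and "\<forall>x\<in>unit_circle. \<forall>y\<in>unit_circle. riem_dist unit_disk g1 x y = riem_dist unit_disk g2 x y"
  shows "\<exists>\<psi>. C21_diffeomorphism unit_disk unit_disk \<psi> \<and>
    (\<forall>p\<in>unit_circle. \<psi> p = p) \<and>
    (\<forall>p\<in>unit_circle. \<forall>v w. pullback_metric unit_disk \<psi> g1 p v w = g2 p v w)"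
proof -
  note g1 = assms(1) and g2 = assms(2)
  define q where "q \<theta> = rot90 (circ \<theta>)" for \<theta>
  define E where "E g \<theta> = g (circ \<theta>) (circ \<theta>) (circ \<theta>)" for g :: "real^2 \<Rightarrow> real^2 \<Rightarrow> real^2 \<Rightarrow> real" and \<theta>
  define F where "F g \<theta> = g (circ \<theta>) (circ \<theta>) (q \<theta>)" for g :: "real^2 \<Rightarrow> real^2 \<Rightarrow> real^2 \<Rightarrow> real" and \<theta>
  define G where "G g \<theta> = g (circ \<theta>) (q \<theta>) (q \<theta>)" for g :: "real^2 \<Rightarrow> real^2 \<Rightarrow> real^2 \<Rightarrow> real" and \<theta>
  \<comment> \<open>The Gram determinant, with \<open>+ -\<close> for subtraction to fit the closure
    rules of \<open>periodic_C11\<close>.\<close>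
  define d where "d g \<theta> = E g \<theta> * G g \<theta> + - (F g \<theta> * F g \<theta>)" for g :: "real^2 \<Rightarrow> real^2 \<Rightarrow> real^2 \<Rightarrow> real" and \<theta>
  \<comment> \<open>The only place where the equality of the distances enters.\<close>
  have GG: "G g2 \<theta> = G g1 \<theta>" for \<theta>
    unfolding G_def q_def by (rule tangential_eq[OF assms, symmetric])
  have G0: "0 < G g1 \<theta>" for \<theta>
    unfolding G_def q_def by (intro metric_pos[OF g1] circ_mem(1) rot90_circ_nonzero)
  have d0: "0 < d g \<theta>" if g: "C11_riemannian_metric unit_disk g" for g \<theta>
  proof -
    have "0 < E g \<theta> * G g \<theta> - F g \<theta> * F g \<theta>"
      unfolding E_def F_def G_def q_def
      by (rule gram_det_pos[OF metric_bilinear[OF g] metric_sym[OF g] metric_pos[OF g] rot90_circ_nonzero circ_add_rot90_nonzero])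
        (rule circ_mem(1))+
    then show ?thesis by (simp add: d_def)
  qed
  have per: "periodic_C11 (E g)" "periodic_C11 (F g)" "periodic_C11 (G g)" "periodic_C11 (d g)"
    if g: "C11_riemannian_metric unit_disk g" for g
  proof -
    show "periodic_C11 (E g)" "periodic_C11 (F g)" "periodic_C11 (G g)"
      unfolding E_def[abs_def] F_def[abs_def] G_def[abs_def] q_def
      by (rule periodic_C11_metric[OF g];
          simp add: periodic_C11_cos periodic_C11_sin periodic_C11_minus)+
    then show "periodic_C11 (d g)" unfolding d_def[abs_def]
      by (intro periodic_C11_add periodic_C11_minus periodic_C11_mult)
  qed
  have ln_d: "periodic_C11 (\<lambda>\<theta>. ln (d g \<theta>))" if g: "C11_riemannian_metric unit_disk g" for g
    using d0[OF g] by (intro periodic_C11_compose[OF per(4)[OF g]] C11_on_ln) auto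
  \<comment> \<open>The differential has determinant \<alpha> = exp(c), and pulling back multiplies
    the Gram determinant by its square. Hence exp(c) has to be the square root of the quotient of
    the determinants.\<close>
  define c where "c \<theta> = 1/2 * (ln (d g2 \<theta>) + - ln (d g1 \<theta>))" for \<theta>
  have c: "periodic_C11 c" unfolding c_def[abs_def]
    by (intro periodic_C11_mult periodic_C11_add periodic_C11_minus periodic_C11_const ln_d g1 g2)
  \<comment> \<open>The solution of \<alpha> F1 + b G1 = F2, the condition on the mixed
    coefficients.\<close>
  define b where "b \<theta> = (F g2 \<theta> + - (exp (c \<theta>) * F g1 \<theta>)) * inverse (G g1 \<theta>)" for \<theta>
  have inv_G: "periodic_C11 (\<lambda>\<theta>. inverse (G g1 \<theta>))"
    using G0 by (intro periodic_C11_compose[OF per(3)[OF g1]] C11_on_real_inverse) auto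
  have exp_c: "periodic_C11 (\<lambda>\<theta>. exp (c \<theta>))"
    by (rule periodic_C11_compose[OF c C11_on_exp])
  have b: "periodic_C11 b" unfolding b_def[abs_def]
    by (intro periodic_C11_mult periodic_C11_add periodic_C11_minus exp_c inv_G per(2) g1 g2)
  obtain \<psi> where \<psi>: "C21_diffeomorphism unit_disk unit_disk \<psi>" "\<forall>p\<in>unit_circle. \<psi> p = p"
    "\<And>\<theta>. (\<psi> has_derivative (\<lambda>v. v + (circ \<theta> \<bullet> v) *\<^sub>R ((exp (c \<theta>) - 1) *\<^sub>R circ \<theta> + b \<theta> *\<^sub>R q \<theta>)))
      (at (circ \<theta>) within unit_disk)"
    using realizable_exp[OF c b] unfolding realizable_def q_def by blast
  have "pullback_metric unit_disk \<psi> g1 (circ \<theta>) v w = g2 (circ \<theta>) v w" for \<theta> v w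
  proof -
    define D where "D = frechet_derivative \<psi> (at (circ \<theta>) within unit_disk)"
    have "\<psi> differentiable (at (circ \<theta>) within unit_disk)" using \<psi>(3) differentiableI by blast
    then have "(\<psi> has_derivative D) (at (circ \<theta>) within unit_disk)"
      unfolding D_def by (simp add: frechet_derivative_works)
    then have D: "D = (\<lambda>v. v + (circ \<theta> \<bullet> v) *\<^sub>R ((exp (c \<theta>) - 1) *\<^sub>R circ \<theta> + b \<theta> *\<^sub>R q \<theta>))"
      by (rule has_derivative_unique_within_convex[OF convex_cball interior_unit_disk circ_mem(1) _ \<psi>(3)])
    define \<alpha> where "\<alpha> = exp (c \<theta>)"
    have Dv: "D v = ((circ \<theta> \<bullet> v) * \<alpha>) *\<^sub>R circ \<theta> + ((circ \<theta> \<bullet> v) * b \<theta> + q \<theta> \<bullet> v) *\<^sub>R q \<theta>" for v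
    proof -
      have "D v = ((circ \<theta> \<bullet> v) *\<^sub>R circ \<theta> + (q \<theta> \<bullet> v) *\<^sub>R q \<theta>)
          + (circ \<theta> \<bullet> v) *\<^sub>R ((\<alpha> - 1) *\<^sub>R circ \<theta> + b \<theta> *\<^sub>R q \<theta>)"
        unfolding D \<alpha>_def q_def circ_decomp[of v \<theta>, symmetric] ..
      then show ?thesis by (simp add: algebra_simps)
    qed
    have bG: "\<alpha> * F g1 \<theta> + b \<theta> * G g1 \<theta> = F g2 \<theta>"
      using less_imp_neq[OF G0[of \<theta>]] by (simp add: b_def \<alpha>_def mult.assoc)
    have "\<alpha> * \<alpha> * d g1 \<theta> = d g2 \<theta>"
    proof -
      have "\<alpha> * \<alpha> = exp (ln (d g2 \<theta>) - ln (d g1 \<theta>))"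
        by (simp add: \<alpha>_def c_def field_simps flip: exp_add)
      then show ?thesis using d0[OF g1, of \<theta>] d0[OF g2, of \<theta>] by (simp add: exp_diff)
    qed
    \<comment> \<open>The normal coefficient matches because the determinant, the mixed and the
      tangential one do: the left side is \<alpha>^2 d1 + (\<alpha> F1 + b G1)^2 = d2 + F2^2 = E2
      G2.\<close>
    then have "G g1 \<theta> * (\<alpha> * \<alpha> * E g1 \<theta> + 2 * \<alpha> * b \<theta> * F g1 \<theta> + b \<theta> * b \<theta> * G g1 \<theta>) = G g1 \<theta> * E g2 \<theta>"
      using bG GG[of \<theta>] unfolding d_def by algebra
    then have EE: "\<alpha> * \<alpha> * E g1 \<theta> + 2 * \<alpha> * b \<theta> * F g1 \<theta> + b \<theta> * b \<theta> * G g1 \<theta> = E g2 \<theta>"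
      using G0[of \<theta>] by simp
    have "pullback_metric unit_disk \<psi> g1 (circ \<theta>) v w = g1 (circ \<theta>) (D v) (D w)"
      using \<psi>(2) by (simp add: pullback_metric_def Let_def D_def)
    also have "\<dots> = (circ \<theta> \<bullet> v) * (circ \<theta> \<bullet> w) * E g2 \<theta>
      + ((circ \<theta> \<bullet> v) * (q \<theta> \<bullet> w) + (q \<theta> \<bullet> v) * (circ \<theta> \<bullet> w)) * F g2 \<theta> + (q \<theta> \<bullet> v) * (q \<theta> \<bullet> w) * G g1 \<theta>"
      unfolding Dv bilinear_frame[OF metric_bilinear[OF g1 circ_mem(1)] metric_sym[OF g1 circ_mem(1)]]
        E_def[symmetric] F_def[symmetric] G_def[symmetric] EE[symmetric] bG[symmetric]
      by (simp add: algebra_simps)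
    also have "\<dots> = g2 (circ \<theta>) ((circ \<theta> \<bullet> v) *\<^sub>R circ \<theta> + (q \<theta> \<bullet> v) *\<^sub>R q \<theta>)
        ((circ \<theta> \<bullet> w) *\<^sub>R circ \<theta> + (q \<theta> \<bullet> w) *\<^sub>R q \<theta>)"
      unfolding bilinear_frame[OF metric_bilinear[OF g2 circ_mem(1)] metric_sym[OF g2 circ_mem(1)]]
        E_def[symmetric] F_def[symmetric] G_def[symmetric] GG ..
    also have "\<dots> = g2 (circ \<theta>) v w" unfolding q_def circ_decomp[symmetric] ..
    finally show ?thesis .
  qed
  then have "\<forall>p\<in>unit_circle. \<forall>v w. pullback_metric unit_disk \<psi> g1 p v w = g2 p v w"
    using circ_surj by metis
  with \<psi>(1,2) show ?thesis by blast
qed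

end
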